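(* Let $A\in\mathbb{Z}^{m\times n}$ have full row rank, i.e. $\operatorname{rank}(A)=m$, and let $\boldsymbol b\in\mathbb{Z}^m$, $\boldsymbol c\in\mathbb{Z}^n$. Assume that the integer optimization problem $$\max\left\{\boldsymbol c^T\boldsymbol x : A\boldsymbol x=\boldsymbol b,\ \boldsymbol x\ge \boldsymbol 0,\ \boldsymbol x\in\mathbb{Z}^n\right\}$$ is feasible. Then there exists an optimal solution $\boldsymbol z^*$ for this problem such that $$|\operatorname{supp}(\boldsymbol z^* )|\le m+\log\left(g^{-1}\sqrt{\det(AA^T)}\right)\le 2m\log\left(2\sqrt{m}\,\|A\|_\infty\right),$$ where $g$ denotes the greatest common divisor of all $m\times m$ minors of $A$.
   Context: For $\boldsymbol x\in\mathbb{R}^n$, $\operatorname{supp}(\boldsymbol x):=\{i\in\{1,\ldots,n\}: x_i\ne 0\}$. $\log$ is the logarithm with base two. $\|A\|_\infty$ denotes the maximum absolute value of an entry of the matrix $A$ (not an operator norm).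
   Formalization: The objective is also assumed bounded above on the feasible set (else no optimum need exist), and the chain is read as one optimal solution whose support size is at most each of the two expressions, since the second inequality between them fails, e.g. for A=(1 1 1 1 1). *)

theory Defs
  imports "HOL-Analysis.Analysis"
begin

definition supp :: "'a::zero ^ 'n \<Rightarrow> 'n set" where
  "supp x = {i. x $ i \<noteq> 0}"

definition max_abs_entry :: "int ^ 'n ^ 'm \<Rightarrow> int" where
  "max_abs_entry A = Max {\<bar>A $ i $ j\<bar> | i j. True}"

(* A minor of maximal order is obtained by selecting CARD('m) distinct columns. The selection
   is an injection from row indices to column indices, so each minor occurs with every ordering
   of its columns, i.e. up to sign; this does not affect the gcd. *)
definition maximal_minors :: "int ^ 'n ^ 'm \<Rightarrow> int set" where
  "maximal_minors A = {det (\<chi> i k. A $ i $ f k) | f :: 'm \<Rightarrow> 'n. inj f}"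

definition gcd_maximal_minors :: "int ^ 'n ^ 'm \<Rightarrow> int" where
  "gcd_maximal_minors A = Gcd (maximal_minors A)"

(* The order on vectors is componentwise. *)
definition ip_feasible :: "int ^ 'n ^ 'm \<Rightarrow> int ^ 'm \<Rightarrow> (int ^ 'n) set" where
  "ip_feasible A b = {x. A *v x = b \<and> x \<ge> 0}"

definition ip_objective :: "int ^ 'n \<Rightarrow> int ^ 'n \<Rightarrow> int" where
  "ip_objective c x = (\<Sum>j\<in>UNIV. c $ j * x $ j)"

definition ip_optimal :: "int ^ 'n ^ 'm \<Rightarrow> int ^ 'm \<Rightarrow> int ^ 'n \<Rightarrow> int ^ 'n \<Rightarrow> bool" where
  "ip_optimal A b c z \<longleftrightarrow>
     z \<in> ip_feasible A b \<and> (\<forall>x\<in>ip_feasible A b. ip_objective c x \<le> ip_objective c z)"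

end

(* Take an optimal solution z of minimal support S. If some nonzero y with entries in {-1, 0, 1},
   supported on S, satisfied A y = 0, then optimality would force c y = 0, and moving from z along y
   would produce an optimal solution of smaller support. So the kernel lattice contains no such y, and
   it remains to bound |S| under this hypothesis (a form of the Bombieri-Vaaler version of Siegel's
   lemma).

   Dividing A by a basis of the lattice A Z^n one may assume that A Z^n = Z^m; this accounts for the
   factor g. Let P be the orthogonal projection onto ker A. Integer translates of the set of all x with
   |(P x)_i| < 1 for i in S, |(P x)_i| < 1/2 for i outside S, and |(A x)_k| < 1/2 are disjoint, so its
   volume is at most 1 (Blichfeldt). By Vaaler's cube slicing argument the volume is at least the
   integral of the Gaussian obtained by replacing each condition |t| < 1/2 by the weight
   exp (- pi t^2): one condition is replaced at a time, the remaining factors having log-concave even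
   marginals by the Prekopa-Leindler inequality. Evaluating the Gaussian gives
   2^(|S| - m) <= sqrt (det (A A^T)) / g.

   The second bound applies the first one to a matrix whose rows are rows of A restricted to S or unit
   vectors outside S, together with Hadamard's inequality. *)

theory Submission
  imports Defs "HOL-Probability.Distributions"
begin

section \<open>The one-dimensional Prekopa-Leindler inequality\<close>

text \<open>The widths of the slabs come from lattice points: if two points of the set differ by an
  integer vector z, then the entries of A z are integers of absolute value below 1, so A z = 0 and P
  z = z. Then |z_i| < 2 on S and |z_i| < 1 off S, so the hypothesis on the kernel lattice gives z =
  0.

  Slabs are imposed on P x rather than on x to decouple the kernel from the row space: the Gaussian
  exponent is then controlled by a block diagonal form, and the row space contributes exactly sqrt
  (det (A A^T)). The kernel vectors supported on S form a space of dimension at least |S| - m; there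
  the weight 1/2 halves lengths, which is the source of 2^(|S| - m).

  Marginals are treated for bounded functions of bounded support only, so the set is first cut by a
  box that later exhausts the space.

  In the second bound, Hadamard's inequality for A itself would give n in place of s = |S|, while
  erasing the columns outside S may lower the rank; the unit vectors restore it. With a the largest
  absolute entry this yields s/m <= log (2 sqrt m a) + log (s/m) / 2, and log t <= t absorbs the
  last term.\<close>

lemma emeasure_convex_combination_le:
  fixes U V W :: "real set"
  assumes U: "convex U" "U \<noteq> {}" "bounded U" and V: "convex V" "V \<noteq> {}" "bounded V"
    and l: "0 < l" "l < 1" and W: "W \<in> sets borel"
    and sub: "\<And>u v. u \<in> U \<Longrightarrow> v \<in> V \<Longrightarrow> l * u + (1 - l) * v \<in> W"
  shows "ennreal l * emeasure lborel U + ennreal (1 - l) * emeasure lborel V \<le> emeasure lborel W"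
proof -
  have bnd: "emeasure lborel X \<le> ennreal (Sup X - Inf X)" "Inf X \<le> Sup X"
    if "X \<noteq> {}" "bounded X" for X :: "real set"
  proof -
    have b: "bdd_above X" "bdd_below X" using that(2) bounded_imp_bdd_above bounded_imp_bdd_below by auto
    show le: "Inf X \<le> Sup X" using that(1) b by (meson all_not_in_conv cInf_lower cSup_upper order_trans)
    have "X \<subseteq> {Inf X..Sup X}" using b by (auto intro: cInf_lower cSup_upper)
    hence "emeasure lborel X \<le> emeasure lborel {Inf X..Sup X}" by (rule emeasure_mono) auto
    thus "emeasure lborel X \<le> ennreal (Sup X - Inf X)" using le by simp
  qed
  let ?a = "l * Inf U + (1 - l) * Inf V" and ?b = "l * Sup U + (1 - l) * Sup V"
  have ab: "?a \<le> ?b" using bnd(2)[OF U(2,3)] bnd(2)[OF V(2,3)] l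
    by (intro add_mono mult_left_mono) auto
  \<comment> \<open>A point \<open>z\<close> strictly between the endpoints is trapped between two
    values \<open>w1 < z < w2\<close> of the combination. Moving the pair \<open>(u1, v1)\<close>
    linearly to \<open>(u2, v2)\<close> stays in \<open>U\<close> and \<open>V\<close> by convexity
    and passes through \<open>z\<close>.\<close>
  have "{?a<..<?b} \<subseteq> W"
  proof
    fix z assume z: "z \<in> {?a<..<?b}"
    obtain u1 v1 where 1: "u1 \<in> U" "v1 \<in> V" "l * u1 + (1 - l) * v1 < z"
    proof -
      define e where "e = z - ?a"
      have e: "e > 0" using z by (simp add: e_def)
      obtain u where u: "u \<in> U" "u < Inf U + e"
        using cInf_lessD[OF U(2), of "Inf U + e"] e by auto
      obtain v where v: "v \<in> V" "v < Inf V + e"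
        using cInf_lessD[OF V(2), of "Inf V + e"] e by auto
      have "l * u < l * (Inf U + e)" "(1 - l) * v < (1 - l) * (Inf V + e)" using u v l by auto
      hence "l * u + (1 - l) * v < z" unfolding e_def by (simp add: algebra_simps)
      thus ?thesis using that u v by blast
    qed
    obtain u2 v2 where 2: "u2 \<in> U" "v2 \<in> V" "l * u2 + (1 - l) * v2 > z"
    proof -
      define e where "e = ?b - z"
      have e: "e > 0" using z by (simp add: e_def)
      obtain u where u: "u \<in> U" "u > Sup U - e"
        using less_cSupD[OF U(2), of "Sup U - e"] e by auto
      obtain v where v: "v \<in> V" "v > Sup V - e"
        using less_cSupD[OF V(2), of "Sup V - e"] e by auto
      have "l * u > l * (Sup U - e)" "(1 - l) * v > (1 - l) * (Sup V - e)" using u v l by auto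
      hence "l * u + (1 - l) * v > z" unfolding e_def by (simp add: algebra_simps)
      thus ?thesis using that u v by blast
    qed
    define w1 w2 where "w1 = l * u1 + (1 - l) * v1" and "w2 = l * u2 + (1 - l) * v2"
    define s where "s = (z - w1) / (w2 - w1)"
    have w: "w1 < z" "z < w2" using 1 2 by (auto simp: w1_def w2_def)
    have s: "0 \<le> s" "s \<le> 1" "z = (1 - s) * w1 + s * w2"
    proof -
      have "s * (w2 - w1) = z - w1" using w by (simp add: s_def)
      thus "z = (1 - s) * w1 + s * w2" by (simp add: algebra_simps)
    qed (use w in \<open>auto simp: s_def\<close>)
    have "(1 - s) * u1 + s * u2 \<in> U" "(1 - s) * v1 + s * v2 \<in> V"
      using U(1) V(1) 1 2 s unfolding convex_alt by auto
    from sub[OF this] show "z \<in> W" unfolding s(3) w1_def w2_def by (simp add: algebra_simps)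
  qed
  hence "ennreal (?b - ?a) \<le> emeasure lborel W"
    using W ab by (metis emeasure_lborel_Ioo emeasure_mono sets_lborel)
  moreover have "?b - ?a = l * (Sup U - Inf U) + (1 - l) * (Sup V - Inf V)" by (simp add: algebra_simps)
  moreover have "ennreal l * emeasure lborel U + ennreal (1 - l) * emeasure lborel V
     \<le> ennreal l * ennreal (Sup U - Inf U) + ennreal (1 - l) * ennreal (Sup V - Inf V)"
    using bnd(1)[OF U(2,3)] bnd(1)[OF V(2,3)] by (intro add_mono mult_left_mono) auto
  moreover have "\<dots> = ennreal (l * (Sup U - Inf U) + (1 - l) * (Sup V - Inf V))"
    using l bnd(2)[OF U(2,3)] bnd(2)[OF V(2,3)] by (simp add: ennreal_mult ennreal_plus)
  ultimately show ?thesis by simp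
qed

text \<open>Tonelli's theorem for the region under the graph. Restricting to positive heights
  matches the way \<open>ennreal\<close> cuts off negative values.\<close>

lemma nn_integral_layer_cake:
  fixes f :: "real \<Rightarrow> real"
  assumes [measurable]: "f \<in> borel_measurable borel"
  shows "(\<integral>\<^sup>+t. ennreal (f t) \<partial>lborel)
    = (\<integral>\<^sup>+s. indicator {0<..} s * emeasure lborel {t. s < f t} \<partial>lborel)"
proof -
    have "(\<integral>\<^sup>+t. ennreal (f t) \<partial>lborel) = (\<integral>\<^sup>+t. (\<integral>\<^sup>+s. indicator {0<..} s * indicator {t. s < f t} t \<partial>lborel) \<partial>lborel)"
  proof (rule nn_integral_cong)
    fix t
    have "(\<integral>\<^sup>+s. indicator {0<..} s * indicator {t. s < f t} t \<partial>lborel) = (\<integral>\<^sup>+s. indicator {0<..<f t} s \<partial>lborel)"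
      by (rule nn_integral_cong) (auto simp: indicator_def)
    also have "\<dots> = ennreal (f t)" by (cases "0 \<le> f t") (auto simp: ennreal_neg)
    finally show "ennreal (f t) = (\<integral>\<^sup>+s. indicator {0<..} s * indicator {t. s < f t} t \<partial>lborel)" by simp
  qed
  also have "\<dots> = (\<integral>\<^sup>+s. (\<integral>\<^sup>+t. indicator {0<..} s * indicator {t. s < f t} t \<partial>lborel) \<partial>lborel)"
    by (rule lborel_pair.Fubini') measurable
  also have "\<dots> = (\<integral>\<^sup>+s. indicator {0<..} s * emeasure lborel {t. s < f t} \<partial>lborel)"
    by (rule nn_integral_cong) (subst nn_integral_cmult, auto)
  finally show ?thesis .
qed

text \<open>Logarithmic concavity, phrased through lower bounds so that it also covers the value \<infinity>.\<close>

definition log_concave :: "('a::real_vector \<Rightarrow> ennreal) \<Rightarrow> bool" where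
  "log_concave F \<longleftrightarrow> (\<forall>x y l a b. 0 < l \<and> l < 1 \<and> 0 \<le> a \<and> 0 \<le> b \<and> ennreal a \<le> F x \<and> ennreal b \<le> F y
     \<longrightarrow> ennreal (a powr l * b powr (1 - l)) \<le> F (l *\<^sub>R x + (1 - l) *\<^sub>R y))"

lemma log_concaveD:
  assumes "log_concave F" "0 < l" "l < 1" "0 \<le> a" "0 \<le> b" "ennreal a \<le> F x" "ennreal b \<le> F y"
  shows "ennreal (a powr l * b powr (1 - l)) \<le> F (l *\<^sub>R x + (1 - l) *\<^sub>R y)"
  using assms unfolding log_concave_def by blast

lemma powr_mult_complement: "(c::real) \<ge> 0 \<Longrightarrow> c powr l * c powr (1 - l) = c"
  by (cases "c = 0") (auto simp flip: powr_add)

lemma Youngs_inequality_nonneg: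
  fixes a b l :: real
  assumes "0 < l" "l < 1" "0 \<le> a" "0 \<le> b"
  shows "a powr l * b powr (1 - l) \<le> l * a + (1 - l) * b"
  using Youngs_inequality_0[of l "1 - l" a b] assms by (cases "a = 0"; cases "b = 0") auto

text \<open>After rescaling both functions to have supremum 1, the superlevel sets at every height in
  \<open>(0,1)\<close> are nonempty, so the one-dimensional Brunn-Minkowski inequality applies height by height.\<close>

lemma Prekopa_Leindler_real:
  fixes f g h :: "real \<Rightarrow> real"
  assumes [measurable]: "f \<in> borel_measurable borel" "g \<in> borel_measurable borel" "h \<in> borel_measurable borel"
    and f0: "\<And>x. 0 \<le> f x" and g0: "\<And>x. 0 \<le> g x"
    and fC: "\<And>x. f x \<le> C" and gC: "\<And>x. g x \<le> C"
    and fr: "\<And>x. \<bar>x\<bar> > r \<Longrightarrow> f x = 0" and gr: "\<And>x. \<bar>x\<bar> > r \<Longrightarrow> g x = 0"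
    and fcx: "\<And>s. 0 < s \<Longrightarrow> convex {x. s < f x}" and gcx: "\<And>s. 0 < s \<Longrightarrow> convex {x. s < g x}"
    and l: "0 < l" "l < 1"
    and hyp: "\<And>x y. f x powr l * g y powr (1 - l) \<le> h (l * x + (1 - l) * y)"
    and A: "0 \<le> A" "ennreal A \<le> (\<integral>\<^sup>+x. ennreal (f x) \<partial>lborel)"
    and B: "0 \<le> B" "ennreal B \<le> (\<integral>\<^sup>+x. ennreal (g x) \<partial>lborel)"
  shows "ennreal (A powr l * B powr (1 - l)) \<le> (\<integral>\<^sup>+x. ennreal (h x) \<partial>lborel)"
proof (cases "(\<exists>x. f x > 0) \<and> (\<exists>x. g x > 0)")
  case False
  then consider "\<And>x. f x = 0" | "\<And>x. g x = 0" using f0 g0 by (metis antisym_conv2)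
  \<comment> \<open>An integral that vanishes forces its lower bound to be 0, and
    \<open>0 powr l = 0\<close> makes the left side trivial.\<close>
  hence "A = 0 \<or> B = 0" using A B by cases auto
  thus ?thesis by auto
next
  case True
  define Sf Sg where "Sf = Sup (range f)" and "Sg = Sup (range g)"
  have bf: "bdd_above (range f)" and bg: "bdd_above (range g)"
    by (rule bdd_aboveI2, rule fC, rule bdd_aboveI2, rule gC)
  have Sf: "f x \<le> Sf" for x unfolding Sf_def by (rule cSup_upper[OF _ bf]) auto
  have Sg: "g x \<le> Sg" for x unfolding Sg_def by (rule cSup_upper[OF _ bg]) auto
  have pos: "Sf > 0" "Sg > 0" using True Sf Sg by (meson less_le_trans)+
  \<comment> \<open>This factor makes the normalised triple satisfy the same pointwise
    hypothesis.\<close>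
  define K where "K = Sf powr l * Sg powr (1 - l)"
  have K: "K > 0" using pos by (simp add: K_def)
  define f' g' h' where "f' x = f x / Sf" and "g' x = g x / Sg" and "h' x = h x / K" for x
  have [measurable]: "f' \<in> borel_measurable borel" "g' \<in> borel_measurable borel" "h' \<in> borel_measurable borel"
    unfolding f'_def g'_def h'_def by measurable
  have hyp': "f' x powr l * g' y powr (1 - l) \<le> h' (l * x + (1 - l) * y)" for x y
  proof -
    have "f' x powr l * g' y powr (1 - l) = f x powr l * g y powr (1 - l) / K"
      using f0 g0 pos by (simp add: f'_def g'_def K_def powr_divide)
    also have "\<dots> \<le> h' (l * x + (1 - l) * y)"
      unfolding h'_def using hyp K by (intro divide_right_mono) auto
    finally show ?thesis .
  qed
  have le1: "f' x \<le> 1" "g' x \<le> 1" for x using Sf Sg pos by (auto simp: f'_def g'_def)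
  have lev: "ennreal l * emeasure lborel {x. s < f' x} + ennreal (1 - l) * emeasure lborel {x. s < g' x}
      \<le> emeasure lborel {x. s < h' x}" if s: "0 < s" "s < 1" for s
  proof (rule emeasure_convex_combination_le[OF _ _ _ _ _ _ l])
    have sf: "{x. s < f' x} = {x. s * Sf < f x}" and sg: "{x. s < g' x} = {x. s * Sg < g x}"
      using pos by (auto simp: f'_def g'_def field_simps)
    show "convex {x. s < f' x}" "convex {x. s < g' x}" unfolding sf sg
      using fcx gcx s pos by simp_all
    have "\<exists>y\<in>range f. s * Sf < y" unfolding Sf_def
      using s pos by (intro less_cSupD) (auto simp: Sf_def)
    thus "{x. s < f' x} \<noteq> {}" unfolding sf by auto
    have "\<exists>y\<in>range g. s * Sg < y" unfolding Sg_def
      using s pos by (intro less_cSupD) (auto simp: Sg_def)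
    thus "{x. s < g' x} \<noteq> {}" unfolding sg by auto
    have "\<bar>x\<bar> \<le> r" if "s < f' x \<or> s < g' x" for x
      using fr[of x] gr[of x] s(1) that by (cases "\<bar>x\<bar> > r") (auto simp: f'_def g'_def)
    hence "{x. s < f' x} \<subseteq> {-r..r}" "{x. s < g' x} \<subseteq> {-r..r}"
      by (auto simp: abs_le_iff minus_le_iff)
    thus "bounded {x. s < f' x}" "bounded {x. s < g' x}" by (meson bounded_closed_interval bounded_subset)+
    show "{x. s < h' x} \<in> sets borel" by measurable
    fix u v assume uv: "u \<in> {x. s < f' x}" "v \<in> {x. s < g' x}"
    have "s = s powr l * s powr (1 - l)" using s by (simp add: powr_mult_complement)
    also have "\<dots> < f' u powr l * g' v powr (1 - l)" using uv s l
      by (intro mult_strict_mono powr_less_mono2) auto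
    also have "\<dots> \<le> h' (l * u + (1 - l) * v)" by (rule hyp')
    finally show "l * u + (1 - l) * v \<in> {x. s < h' x}" by simp
  qed
  \<comment> \<open>For the normalised functions an arithmetic mean of the integrals is obtained, by
    integrating the level-set inequality over the height. Heights \<open>s\<close> from 1 upwards
    contribute nothing on the left.\<close>
  have "ennreal l * (\<integral>\<^sup>+x. f' x \<partial>lborel) + ennreal (1 - l) * (\<integral>\<^sup>+x. g' x \<partial>lborel)
     = (\<integral>\<^sup>+s. ennreal l * (indicator {0<..} s * emeasure lborel {x. s < f' x}) 
            + ennreal (1 - l) * (indicator {0<..} s * emeasure lborel {x. s < g' x}) \<partial>lborel)"
    unfolding nn_integral_layer_cake[OF \<open>f' \<in> _\<close>] nn_integral_layer_cake[OF \<open>g' \<in> _\<close>]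
    by (subst nn_integral_add) (auto simp: nn_integral_cmult)
  also have "\<dots> \<le> (\<integral>\<^sup>+s. indicator {0<..} s * emeasure lborel {x. s < h' x} \<partial>lborel)"
  proof (rule nn_integral_mono)
    fix s :: real
    show "ennreal l * (indicator {0<..} s * emeasure lborel {x. s < f' x}) 
            + ennreal (1 - l) * (indicator {0<..} s * emeasure lborel {x. s < g' x})
       \<le> indicator {0<..} s * emeasure lborel {x. s < h' x}"
    proof (cases "0 < s \<and> s < 1")
      case True thus ?thesis using lev[of s] by simp
    next
      case False
      have "{x. s < f' x} = {}" "{x. s < g' x} = {}" if "s \<ge> 1" using le1 that by (auto simp: not_less intro: order_trans)
      thus ?thesis using False by (cases "s > 0") auto
    qed
  qed
  also have "\<dots> = (\<integral>\<^sup>+x. h' x \<partial>lborel)" by (rule nn_integral_layer_cake[symmetric]) measurable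
  finally have main: "ennreal l * (\<integral>\<^sup>+x. f' x \<partial>lborel) + ennreal (1 - l) * (\<integral>\<^sup>+x. g' x \<partial>lborel) \<le> (\<integral>\<^sup>+x. h' x \<partial>lborel)" .
  have If: "ennreal (A / Sf) \<le> (\<integral>\<^sup>+x. f' x \<partial>lborel)"
  proof -
    have "ennreal (A / Sf) = ennreal (1 / Sf) * ennreal A" using pos A by (simp flip: ennreal_mult)
    also have "\<dots> \<le> ennreal (1 / Sf) * (\<integral>\<^sup>+x. f x \<partial>lborel)" using A by (intro mult_left_mono) auto
    also have "\<dots> = (\<integral>\<^sup>+x. f' x \<partial>lborel)" using pos f0
      by (subst nn_integral_cmult[symmetric]) (auto simp: f'_def simp flip: ennreal_mult)
    finally show ?thesis .
  qed
  have Ig: "ennreal (B / Sg) \<le> (\<integral>\<^sup>+x. g' x \<partial>lborel)"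
  proof -
    have "ennreal (B / Sg) = ennreal (1 / Sg) * ennreal B" using pos B by (simp flip: ennreal_mult)
    also have "\<dots> \<le> ennreal (1 / Sg) * (\<integral>\<^sup>+x. g x \<partial>lborel)" using B by (intro mult_left_mono) auto
    also have "\<dots> = (\<integral>\<^sup>+x. g' x \<partial>lborel)" using pos g0
      by (subst nn_integral_cmult[symmetric]) (auto simp: g'_def simp flip: ennreal_mult)
    finally show ?thesis .
  qed
  have h0: "0 \<le> h x" for x
    using hyp[of x x] by (simp add: algebra_simps) (meson mult_nonneg_nonneg order_trans powr_ge_zero)
  \<comment> \<open>The arithmetic-geometric mean inequality returns to the multiplicative form; the
    powers of \<open>Sf\<close> and \<open>Sg\<close> cancel against \<open>K\<close>.\<close>
  have "A powr l * B powr (1 - l) = K * ((A / Sf) powr l * (B / Sg) powr (1 - l))"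
    using A B pos by (simp add: K_def powr_divide)
  also have "\<dots> \<le> K * (l * (A / Sf) + (1 - l) * (B / Sg))"
    using A B pos l K by (intro mult_left_mono Youngs_inequality_nonneg) auto
  finally have "ennreal (A powr l * B powr (1 - l)) \<le> ennreal (K * (l * (A / Sf) + (1 - l) * (B / Sg)))"
    by (rule ennreal_leI)
  also have "\<dots> = ennreal K * (ennreal l * ennreal (A / Sf) + ennreal (1 - l) * ennreal (B / Sg))"
    using K l A B pos by (simp flip: ennreal_mult ennreal_plus)
  also have "\<dots> \<le> ennreal K * (ennreal l * (\<integral>\<^sup>+x. f' x \<partial>lborel) + ennreal (1 - l) * (\<integral>\<^sup>+x. g' x \<partial>lborel))"
    using If Ig by (intro mult_left_mono add_mono) auto
  also have "\<dots> \<le> ennreal K * (\<integral>\<^sup>+x. h' x \<partial>lborel)" using main by (intro mult_left_mono) auto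
  also have "\<dots> = (\<integral>\<^sup>+x. ennreal (h x) \<partial>lborel)" using K h0
    by (subst nn_integral_cmult[symmetric]) (auto simp: h'_def simp flip: ennreal_mult)
  finally show ?thesis .
qed

section \<open>Marginals of log-concave functions\<close>

text \<open>Restricted to the parallel lines through \<open>x\<close>, \<open>y\<close> and their
  combination, \<open>F\<close> gives three functions to which the one-dimensional inequality
  applies. The bounds \<open>C\<close> and \<open>r\<close> make these functions finite and their
  superlevel sets bounded.\<close>

lemma log_concave_marginal:
  fixes F :: "'a::euclidean_space \<Rightarrow> ennreal"
  assumes [measurable]: "F \<in> borel_measurable borel"
    and F: "log_concave F" and C: "\<And>p. F p \<le> ennreal C"
    and r: "\<And>p t. \<bar>t\<bar> > r p \<Longrightarrow> F (p + t *\<^sub>R e) = 0"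
  shows "log_concave (\<lambda>p. \<integral>\<^sup>+t. F (p + t *\<^sub>R e) \<partial>lborel)"
  unfolding log_concave_def
proof (intro allI impI, elim conjE)
  fix x y :: 'a and l a b :: real
  assume l: "0 < l" "l < 1" and a: "0 \<le> a" "ennreal a \<le> (\<integral>\<^sup>+t. F (x + t *\<^sub>R e) \<partial>lborel)"
    and b: "0 \<le> b" "ennreal b \<le> (\<integral>\<^sup>+t. F (y + t *\<^sub>R e) \<partial>lborel)"
  define f where "f p t = enn2real (F (p + t *\<^sub>R e))" for p t
  have Ff: "F (p + t *\<^sub>R e) = ennreal (f p t)" for p t
    unfolding f_def using C[of "p + t *\<^sub>R e"]
    by (metis ennreal_enn2real ennreal_less_top order_le_less_trans)
  have f0: "0 \<le> f p t" for p t by (simp add: f_def)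
  have [measurable]: "f p \<in> borel_measurable borel" for p unfolding f_def by measurable
  have fC: "f p t \<le> max C 0" for p t
    using C[of "p + t *\<^sub>R e"] unfolding Ff by (metis ennreal_le_iff2 f0 max.coboundedI1 max.coboundedI2 order.trans)
  have fr: "f p t = 0" if "\<bar>t\<bar> > max (r x) (r y)" "p = x \<or> p = y" for p t
    using r[of p t] that by (auto simp: f_def)
  have lc: "f p s powr k * f q t powr (1 - k) \<le> f (k *\<^sub>R p + (1 - k) *\<^sub>R q) (k * s + (1 - k) * t)"
    if k: "0 < k" "k < 1" for p q s t k
  proof -
    have "ennreal (f p s powr k * f q t powr (1 - k)) \<le> F (k *\<^sub>R (p + s *\<^sub>R e) + (1 - k) *\<^sub>R (q + t *\<^sub>R e))"
      by (rule log_concaveD[OF F k f0 f0]) (simp_all add: Ff)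
    also have "k *\<^sub>R (p + s *\<^sub>R e) + (1 - k) *\<^sub>R (q + t *\<^sub>R e)
        = (k *\<^sub>R p + (1 - k) *\<^sub>R q) + (k * s + (1 - k) * t) *\<^sub>R e" by (simp add: algebra_simps)
    finally show ?thesis unfolding Ff using f0 by simp
  qed
  have cx: "convex {t. s < f p t}" if s: "0 < s" for s p
    unfolding convex_alt
  proof (intro ballI allI impI)
    fix t u k :: real assume t: "t \<in> {t. s < f p t}" and u: "u \<in> {t. s < f p t}" and k: "0 \<le> k \<and> k \<le> 1"
    show "(1 - k) *\<^sub>R t + k *\<^sub>R u \<in> {t. s < f p t}"
    proof (cases "k = 0 \<or> k = 1")
      case False
      \<comment> \<open>Superlevel sets are convex because the geometric mean of two values is at
        least their minimum.\<close>
      define m where "m = min (f p t) (f p u)"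
      have m: "s < m" "m \<ge> 0" using t u s by (auto simp: m_def)
      have "s < m powr (1 - k) * m powr k" using m(1) powr_mult_complement[OF m(2), of k] by (simp add: mult.commute)
      also have "\<dots> \<le> f p t powr (1 - k) * f p u powr k"
        using k m f0 by (intro mult_mono powr_mono2) (auto simp: m_def)
      also have "\<dots> \<le> f p ((1 - k) * t + k * u)"
        using lc[of "1 - k" p t p u] k False by (simp flip: scaleR_left_distrib)
      finally show ?thesis by simp
    qed (use t u in auto)
  qed
  have "ennreal (a powr l * b powr (1 - l)) \<le> (\<integral>\<^sup>+t. ennreal (f (l *\<^sub>R x + (1 - l) *\<^sub>R y) t) \<partial>lborel)"
    by (rule Prekopa_Leindler_real[where f = "f x" and g = "f y" and C = "max C 0" and r = "max (r x) (r y)"])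
       (use l f0 fC fr cx lc a b in \<open>auto simp flip: Ff\<close>)
  thus "ennreal (a powr l * b powr (1 - l)) \<le> (\<integral>\<^sup>+t. F (l *\<^sub>R x + (1 - l) *\<^sub>R y + t *\<^sub>R e) \<partial>lborel)"
    by (simp flip: Ff)
qed

text \<open>The marginal over the span of \<open>B\<close> remains a function on the whole space, so
  no type for the complementary subspace is needed and directions can be integrated out by induction
  on \<open>B\<close>.\<close>

definition partial_integral :: "'a::euclidean_space set \<Rightarrow> ('a \<Rightarrow> ennreal) \<Rightarrow> 'a \<Rightarrow> ennreal" where
  "partial_integral B f p = (\<integral>\<^sup>+y. f (p + (\<Sum>b\<in>B. y b *\<^sub>R b)) \<partial>(\<Pi>\<^sub>M b\<in>B. lborel))"

interpretation lborel_product: product_sigma_finite "\<lambda>_. lborel :: real measure" ..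

lemma borel_measurable_line_integral [measurable]:
  fixes f :: "'a::euclidean_space \<Rightarrow> ennreal"
  assumes [measurable]: "f \<in> borel_measurable borel"
  shows "(\<lambda>p. \<integral>\<^sup>+t. f (p + t *\<^sub>R e) \<partial>lborel) \<in> borel_measurable borel"
  by measurable

lemma partial_integral_empty [simp]: "partial_integral {} f p = f p"
  by (simp add: partial_integral_def PiM_empty nn_integral_count_space_finite)

lemma partial_integral_insert:
  fixes f :: "'a::euclidean_space \<Rightarrow> ennreal"
  assumes "finite B" "e \<notin> B" and [measurable]: "f \<in> borel_measurable borel"
  shows "partial_integral (insert e B) f p = partial_integral B (\<lambda>q. \<integral>\<^sup>+t. f (q + t *\<^sub>R e) \<partial>lborel) p"
proof -
  have *: "(\<Sum>b\<in>insert e B. (y(e := t)) b *\<^sub>R b) = t *\<^sub>R e + (\<Sum>b\<in>B. y b *\<^sub>R b)" for y t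
    using assms by (subst sum.insert) (auto intro!: sum.cong)
  show ?thesis unfolding partial_integral_def
    by (subst lborel_product.product_nn_integral_insert[OF assms(1,2)])
       (auto simp: * algebra_simps simp del: fun_upd_apply intro!: nn_integral_cong)
qed

lemma borel_measurable_partial_integral [measurable]:
  fixes f :: "'a::euclidean_space \<Rightarrow> ennreal"
  assumes "finite B" "f \<in> borel_measurable borel"
  shows "partial_integral B f \<in> borel_measurable borel"
  using assms
proof (induction B arbitrary: f rule: finite_induct)
  case (insert e B)
  note [measurable] = insert.prems
  have "partial_integral (insert e B) f = partial_integral B (\<lambda>q. \<integral>\<^sup>+t. f (q + t *\<^sub>R e) \<partial>lborel)"
    using insert by (intro ext partial_integral_insert)
  thus ?case using insert.IH[of "\<lambda>q. \<integral>\<^sup>+t. f (q + t *\<^sub>R e) \<partial>lborel"] by simp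
qed (simp add: partial_integral_empty[abs_def])

lemma nn_integral_eq_partial_integral:
  fixes f :: "'a::euclidean_space \<Rightarrow> ennreal"
  assumes [measurable]: "f \<in> borel_measurable borel"
  shows "(\<integral>\<^sup>+x. f x \<partial>lborel) = partial_integral Basis f 0"
  unfolding partial_integral_def
  by (subst lborel_eq, subst nn_integral_distr) auto

lemma nn_integral_split_direction:
  fixes f :: "'a::euclidean_space \<Rightarrow> ennreal"
  assumes e: "e \<in> Basis" and [measurable]: "f \<in> borel_measurable borel"
  shows "(\<integral>\<^sup>+x. f x \<partial>lborel) = partial_integral (Basis - {e}) (\<lambda>q. \<integral>\<^sup>+t. f (q + t *\<^sub>R e) \<partial>lborel) 0"
  using partial_integral_insert[of "Basis - {e}" e f 0] e
  by (simp add: nn_integral_eq_partial_integral insert_absorb)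

text \<open>Here the direction \<open>e\<close> is outermost, so a factor depending only on the
  \<open>e\<close>-coordinate can be pulled out of the inner integral.\<close>

lemma nn_integral_split_direction_swap:
  fixes f :: "'a::euclidean_space \<Rightarrow> ennreal"
  assumes e: "e \<in> Basis" and [measurable]: "f \<in> borel_measurable borel"
  shows "(\<integral>\<^sup>+x. f x \<partial>lborel) = (\<integral>\<^sup>+t. partial_integral (Basis - {e}) f (t *\<^sub>R e) \<partial>lborel)"
proof -
  have *: "(\<Sum>b\<in>Basis. (y(e := t)) b *\<^sub>R b) = t *\<^sub>R e + (\<Sum>b\<in>Basis - {e}. y b *\<^sub>R b)" for y t
    using e by (subst sum.remove[of _ e]) (auto intro!: sum.cong)
  have "(\<integral>\<^sup>+x. f x \<partial>lborel) = (\<integral>\<^sup>+y. f (\<Sum>b\<in>Basis. y b *\<^sub>R b) \<partial>(\<Pi>\<^sub>M b\<in>insert e (Basis - {e}). lborel))"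
    using e by (simp add: nn_integral_eq_partial_integral partial_integral_def insert_absorb)
  also have "\<dots> = (\<integral>\<^sup>+t. (\<integral>\<^sup>+y. f (\<Sum>b\<in>Basis. (y(e := t)) b *\<^sub>R b) \<partial>(\<Pi>\<^sub>M b\<in>Basis - {e}. lborel)) \<partial>lborel)"
    by (rule lborel_product.product_nn_integral_insert_rev) (use e in \<open>simp_all add: insert_absorb\<close>)
  finally show ?thesis unfolding partial_integral_def * .
qed

text \<open>Integration along \<open>B\<close> never leaves the hyperplane orthogonal to
  \<open>e\<close>. This matters for substitutions along \<open>e\<close> that are valid only from
  base points in that hyperplane.\<close>

lemma partial_integral_cong_on:
  assumes "finite B" "B \<subseteq> Basis" "p \<bullet> e = 0" "e \<in> Basis - B" "\<And>q. q \<bullet> e = 0 \<Longrightarrow> f q = g q"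
  shows "partial_integral B f p = partial_integral B g p"
  unfolding partial_integral_def
proof (rule nn_integral_cong)
  fix y
  have "b \<bullet> e = 0" if "b \<in> B" for b
    using assms(2,4) that by (intro inner_not_same_Basis) auto
  hence "(\<Sum>b\<in>B. y b *\<^sub>R b) \<bullet> e = 0" unfolding inner_sum_left
    by (intro sum.neutral) simp
  thus "f (p + (\<Sum>b\<in>B. y b *\<^sub>R b)) = g (p + (\<Sum>b\<in>B. y b *\<^sub>R b))"
    using assms(3) by (intro assms(5)) (simp add: inner_add_left)
qed

text \<open>One direction is integrated out at a time, and the bounds must survive: the line
  integral is at most \<open>C\<close> times the length of an interval of radius
  \<open>\<bar>N\<bar>\<close>, while the coordinates in the other directions are unaffected by
  moving along \<open>e\<close>.\<close>

lemma log_concave_partial_integral: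
  fixes F :: "'a::euclidean_space \<Rightarrow> ennreal"
  assumes "finite B" "B \<subseteq> Basis" "F \<in> borel_measurable borel"
    and "log_concave F" "\<And>p. F p \<le> ennreal C"
    and "\<And>p b. b \<in> B \<Longrightarrow> F p \<noteq> 0 \<Longrightarrow> \<bar>p \<bullet> b\<bar> \<le> N"
  shows "log_concave (partial_integral B F)"
  using assms
proof (induction B arbitrary: F C rule: finite_induct)
  case empty thus ?case by (simp add: partial_integral_empty[abs_def])
next
  case (insert e B)
  note [measurable] = insert.prems(2)
  let ?G = "\<lambda>q. \<integral>\<^sup>+t. F (q + t *\<^sub>R e) \<partial>lborel"
  have e: "e \<in> Basis" using insert.prems by auto
  have eq: "partial_integral (insert e B) F = partial_integral B ?G"
    using insert.hyps by (intro ext partial_integral_insert) measurable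
  have zero: "F (p + t *\<^sub>R e) = 0" if "\<bar>t\<bar> > N + \<bar>p \<bullet> e\<bar>" for p t
  proof (rule ccontr)
    assume "F (p + t *\<^sub>R e) \<noteq> 0"
    hence "\<bar>p \<bullet> e + t\<bar> \<le> N" using insert.prems(5)[of e "p + t *\<^sub>R e"] e by (simp add: inner_add_left)
    thus False using that by linarith
  qed
  have "log_concave (partial_integral B ?G)"
  proof (rule insert.IH)
    show "log_concave ?G"
      by (rule log_concave_marginal[where r = "\<lambda>p. N + \<bar>p \<bullet> e\<bar>"]) (use insert.prems zero in auto)
    show "?G p \<le> ennreal (C * (2 * \<bar>N\<bar>))" for p
    proof -
      have "?G p \<le> (\<integral>\<^sup>+t. ennreal C * indicator {- \<bar>N\<bar> - p \<bullet> e..\<bar>N\<bar> - p \<bullet> e} t \<partial>lborel)"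
      proof (rule nn_integral_mono)
        fix t
        show "F (p + t *\<^sub>R e) \<le> ennreal C * indicator {- \<bar>N\<bar> - p \<bullet> e..\<bar>N\<bar> - p \<bullet> e} t"
          using insert.prems(4)[of "p + t *\<^sub>R e"] insert.prems(5)[of e "p + t *\<^sub>R e"] e
          by (cases "F (p + t *\<^sub>R e) = 0") (auto simp: inner_add_left indicator_def)
      qed
      also have "\<dots> = ennreal C * ennreal (2 * \<bar>N\<bar>)"
        by (subst nn_integral_cmult) auto
      also have "\<dots> = ennreal (C * (2 * \<bar>N\<bar>))" by (simp add: ennreal_mult'')
      finally show ?thesis .
    qed
    show "\<bar>p \<bullet> b\<bar> \<le> N" if b: "b \<in> B" and nz: "?G p \<noteq> 0" for p b
    proof (rule ccontr)
      assume *: "\<not> \<bar>p \<bullet> b\<bar> \<le> N"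
      have "e \<bullet> b = 0" using b insert.prems(1) insert.hyps e by (intro inner_not_same_Basis) auto
      hence "F (p + t *\<^sub>R e) = 0" for t
        using insert.prems(5)[of b "p + t *\<^sub>R e"] b * by (auto simp: inner_add_left)
      thus False using nz by simp
    qed
  qed (use insert.prems in auto)
  thus ?case unfolding eq .
qed

lemma partial_integral_even:
  fixes F :: "'a::euclidean_space \<Rightarrow> ennreal"
  assumes "finite B" "F \<in> borel_measurable borel" "\<And>p. F (- p) = F p"
  shows "partial_integral B F (- p) = partial_integral B F p"
  using assms
proof (induction B arbitrary: F p rule: finite_induct)
  case (insert e B)
  note [measurable] = insert.prems(1)
  let ?G = "\<lambda>q. \<integral>\<^sup>+t. F (q + t *\<^sub>R e) \<partial>lborel"
  have "?G (- q) = ?G q" for q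
  proof -
    have "?G (- q) = (\<integral>\<^sup>+t. F (- q + (0 + (-1) * t) *\<^sub>R e) \<partial>lborel)"
      by (subst nn_integral_real_affine[where c = "-1" and t = 0]) auto
    also have "\<dots> = (\<integral>\<^sup>+t. F (- (q + t *\<^sub>R e)) \<partial>lborel)" by (simp add: algebra_simps)
    finally show ?thesis by (simp only: insert.prems(2))
  qed
  hence "partial_integral B ?G (- p) = partial_integral B ?G p" by (intro insert.IH) measurable
  thus ?case using insert.hyps by (simp add: partial_integral_insert)
qed auto

section \<open>Vaaler's Gaussian lower bound for symmetric slabs\<close>

lemma log_concave_linear_comp:
  assumes "log_concave F" "linear L"
  shows "log_concave (\<lambda>x. F (L x))"
  using assms(1) unfolding log_concave_def linear_add[OF assms(2)] linear_cmul[OF assms(2)] by blast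

lemma log_concave_even_antimono:
  fixes H :: "real \<Rightarrow> ennreal"
  assumes H: "log_concave H" and ev: "\<And>u. H (- u) = H u" and uv: "\<bar>u\<bar> \<le> \<bar>v\<bar>"
  shows "H v \<le> H u"
proof (cases "\<bar>u\<bar> = \<bar>v\<bar>")
  case True thus ?thesis using ev by (auto simp: abs_eq_iff)
next
  case False
  hence v: "\<bar>u\<bar> < \<bar>v\<bar>" using uv by simp
  \<comment> \<open>The weight that writes \<open>u\<close> as a combination of \<open>v\<close> and
    \<open>- v\<close>, where \<open>H\<close> takes equal values.\<close>
  define l where "l = (u / v + 1) / 2"
  have "\<bar>u / v\<bar> < 1" using v by (simp add: abs_divide)
  hence "-1 < u / v \<and> u / v < 1" unfolding abs_less_iff by linarith
  hence l: "0 < l" "l < 1" by (simp_all add: l_def)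
  have u: "u = l *\<^sub>R v + (1 - l) *\<^sub>R (- v)" using v by (simp add: l_def field_simps)
  have *: "ennreal a \<le> H u" if a: "0 \<le> a" "ennreal a \<le> H v" for a
  proof -
    have "ennreal (a powr l * a powr (1 - l)) \<le> H (l *\<^sub>R v + (1 - l) *\<^sub>R (- v))"
      by (rule log_concaveD[OF H l a(1) a(1)]) (use a ev in auto)
    thus ?thesis using a powr_mult_complement[of a l] u by simp
  qed
  show ?thesis
  proof (cases "H v")
    case (real r) thus ?thesis using *[of r] by simp
  next
    case top
    \<comment> \<open>An infinite value is used through all its finite lower bounds.\<close>
    hence "of_nat n \<le> H u" for n using *[of "real n"] by (simp add: ennreal_of_nat_eq_real_of_nat)
    hence "\<not> H u < top" using ennreal_Ex_less_of_nat by (metis not_le)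
    thus ?thesis by (simp add: top.not_eq_extremum[symmetric])
  qed
qed

text \<open>The constant \<open>pi\<close> in the exponent gives the Gaussian the same mass as the
  interval of length 1 with which it is compared.\<close>

lemma nn_integral_gaussian: "(\<integral>\<^sup>+u. ennreal (exp (- (pi * u\<^sup>2))) \<partial>lborel) = 1"
proof -
  have "(\<integral>\<^sup>+x. ennreal (normal_density 0 (1 / sqrt (2 * pi)) x) \<partial>lborel) = 1"
    by (subst nn_integral_eq_integral) (auto simp: integral_normal_density)
  moreover have "normal_density 0 (1 / sqrt (2 * pi)) x = exp (- (pi * x\<^sup>2))" for x
    by (simp add: normal_density_def power_divide)
  ultimately show ?thesis by simp
qed

text \<open>The two weights have the same total mass and their difference changes sign only at
  \<open>\<bar>u\<bar> = 1/2\<close>, so comparing the weight \<open>H\<close> with its value \<open>H (1/2)\<close> suffices.\<close>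

lemma gaussian_le_interval:
  fixes H :: "real \<Rightarrow> ennreal"
  assumes [measurable]: "H \<in> borel_measurable borel"
    and mono: "\<And>u v. \<bar>u\<bar> \<le> \<bar>v\<bar> \<Longrightarrow> H v \<le> H u"
  shows "(\<integral>\<^sup>+u. ennreal (exp (- (pi * u\<^sup>2))) * H u \<partial>lborel)
    \<le> (\<integral>\<^sup>+u. indicator {-1/2<..<1/2} u * H u \<partial>lborel)" (is "?I \<le> ?J")
proof (cases "H (1/2) = top")
  case True
  have "H u = top" if "\<bar>u\<bar> \<le> 1/2" for u
    using mono[of u "1/2"] that True by (simp add: top.extremum_unique)
  hence "?J = (\<integral>\<^sup>+u. top * indicator {-1/2<..<1/2::real} u \<partial>lborel)"
    by (intro nn_integral_cong) (auto simp: indicator_def)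
  also have "\<dots> = top" by (subst nn_integral_cmult) (auto simp: ennreal_top_mult)
  finally show ?thesis by simp
next
  case False
  let ?g = "\<lambda>u. ennreal (exp (- (pi * u\<^sup>2)))" and ?f = "\<lambda>u. indicator {-1/2<..<1/2} u :: ennreal"
  \<comment> \<open>The sign argument is written with sums, since subtraction in
    \<open>ennreal\<close> truncates. The common term \<open>H (1/2)\<close> is cancelled at the
    end, which is why its being infinite is a separate case.\<close>
  have pt: "?g u * H u + ?f u * H (1/2) \<le> ?f u * H u + ?g u * H (1/2)" for u
  proof (cases "u \<in> {-1/2<..<1/2}")
    case True
    define q where "q = exp (- (pi * u\<^sup>2))"
    have q: "0 \<le> q" "q \<le> 1" by (auto simp: q_def)
    have s: "z = ennreal (1 - q) * z + ennreal q * z" for z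
      using q by (simp flip: distrib_right ennreal_plus)
    have "ennreal q * H u + H (1/2) = ennreal q * H u + (ennreal (1 - q) * H (1/2) + ennreal q * H (1/2))"
      using s[of "H (1/2)"] by simp
    also have "\<dots> \<le> ennreal q * H u + (ennreal (1 - q) * H u + ennreal q * H (1/2))"
      using True by (intro add_left_mono add_right_mono mult_left_mono mono) auto
    also have "\<dots> = (ennreal (1 - q) * H u + ennreal q * H u) + ennreal q * H (1/2)" by (simp add: ac_simps)
    also have "\<dots> = H u + ennreal q * H (1/2)" using s[of "H u"] by simp
    finally show ?thesis using True by (simp add: q_def)
  next
    case False
    hence "?g u * H u \<le> ?g u * H (1/2)" by (intro mult_left_mono mono) (auto simp: abs_if)
    thus ?thesis using False by simp
  qed
  have "?I + H (1/2) = (\<integral>\<^sup>+u. ?g u * H u + ?f u * H (1/2) \<partial>lborel)"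
    by (subst nn_integral_add) (auto simp: nn_integral_multc)
  also have "\<dots> \<le> (\<integral>\<^sup>+u. ?f u * H u + ?g u * H (1/2) \<partial>lborel)" by (intro nn_integral_mono pt)
  also have "\<dots> = ?J + H (1/2)"
    by (subst nn_integral_add) (auto simp: nn_integral_multc nn_integral_gaussian)
  finally have "H (1/2) + ?I \<le> H (1/2) + ?J" by (simp add: add.commute)
  thus ?thesis using False by (simp add: ennreal_add_left_cancel_le)
qed

text \<open>The coordinate along \<open>e\<close> is replaced by the value \<open>u\<close> of the
  linear form. The map \<open>L\<close> moves points only along \<open>e\<close> and satisfies
  \<open>v \<bullet> L x = x \<bullet> e\<close>, so it carries coordinate hyperplanes to level sets
  of the form; \<open>1 / \<bar>c\<bar>\<close> is the Jacobian.\<close>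

lemma nn_integral_slab_disintegration:
  fixes R :: "'a::euclidean_space \<Rightarrow> ennreal" and v e :: 'a
  defines "c \<equiv> v \<bullet> e"
  defines "L \<equiv> \<lambda>x. (x - (x \<bullet> e) *\<^sub>R e) + ((x \<bullet> e - v \<bullet> (x - (x \<bullet> e) *\<^sub>R e)) / c) *\<^sub>R e"
  assumes e: "e \<in> Basis" and c: "v \<bullet> e \<noteq> 0"
    and [measurable]: "R \<in> borel_measurable borel" "\<phi> \<in> borel_measurable borel"
  shows "(\<integral>\<^sup>+x. \<phi> (v \<bullet> x) * R x \<partial>lborel)
     = ennreal (1 / \<bar>c\<bar>) * (\<integral>\<^sup>+u. \<phi> u * partial_integral (Basis - {e}) (\<lambda>x. R (L x)) (u *\<^sub>R e) \<partial>lborel)"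
proof -
  have c0: "c \<noteq> 0" using c by (simp add: c_def)
  have ee: "e \<bullet> e = 1" using e by simp
  have [measurable]: "(\<lambda>x. R (L x)) \<in> borel_measurable borel" unfolding L_def by measurable
  have line: "(\<integral>\<^sup>+t. \<phi> (v \<bullet> (q + t *\<^sub>R e)) * R (q + t *\<^sub>R e) \<partial>lborel)
       = (\<integral>\<^sup>+u. ennreal (1 / \<bar>c\<bar>) * (\<phi> ((q + u *\<^sub>R e) \<bullet> e) * R (L (q + u *\<^sub>R e))) \<partial>lborel)"
    if q: "q \<bullet> e = 0" for q
  proof -
    have 1: "v \<bullet> L (q + u *\<^sub>R e) = (q + u *\<^sub>R e) \<bullet> e" for u
      using c0 q ee by (simp add: L_def inner_add_left inner_add_right field_simps flip: c_def)
    have 2: "q + (- (v \<bullet> q) / c + 1 / c * u) *\<^sub>R e = L (q + u *\<^sub>R e)" for u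
      using q ee by (simp add: L_def inner_add_left diff_divide_distrib)
    have "(\<integral>\<^sup>+t. \<phi> (v \<bullet> (q + t *\<^sub>R e)) * R (q + t *\<^sub>R e) \<partial>lborel)
      = ennreal \<bar>1 / c\<bar> * (\<integral>\<^sup>+u. \<phi> (v \<bullet> (q + (- (v \<bullet> q) / c + 1 / c * u) *\<^sub>R e)) * R (q + (- (v \<bullet> q) / c + 1 / c * u) *\<^sub>R e) \<partial>lborel)"
      by (rule nn_integral_real_affine) (use c0 in auto)
    thus ?thesis unfolding 2 1 by (subst nn_integral_cmult) auto
  qed
  have "(\<integral>\<^sup>+x. \<phi> (v \<bullet> x) * R x \<partial>lborel)
    = partial_integral (Basis - {e}) (\<lambda>q. \<integral>\<^sup>+t. \<phi> (v \<bullet> (q + t *\<^sub>R e)) * R (q + t *\<^sub>R e) \<partial>lborel) 0"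
    using e by (rule nn_integral_split_direction) measurable
  also have "\<dots> = partial_integral (Basis - {e}) (\<lambda>q. \<integral>\<^sup>+u. ennreal (1 / \<bar>c\<bar>) * (\<phi> ((q + u *\<^sub>R e) \<bullet> e) * R (L (q + u *\<^sub>R e))) \<partial>lborel) 0"
    using e by (intro partial_integral_cong_on[where e = e] line) auto
  also have "\<dots> = (\<integral>\<^sup>+x. ennreal (1 / \<bar>c\<bar>) * (\<phi> (x \<bullet> e) * R (L x)) \<partial>lborel)"
    using e by (intro nn_integral_split_direction[symmetric]) measurable
  also have "\<dots> = ennreal (1 / \<bar>c\<bar>) * (\<integral>\<^sup>+x. \<phi> (x \<bullet> e) * R (L x) \<partial>lborel)"
    by (rule nn_integral_cmult) measurable
  also have "(\<integral>\<^sup>+x. \<phi> (x \<bullet> e) * R (L x) \<partial>lborel)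
      = (\<integral>\<^sup>+u. partial_integral (Basis - {e}) (\<lambda>x. \<phi> (x \<bullet> e) * R (L x)) (u *\<^sub>R e) \<partial>lborel)"
    using e by (intro nn_integral_split_direction_swap) measurable
  also have "\<dots> = (\<integral>\<^sup>+u. \<phi> u * partial_integral (Basis - {e}) (\<lambda>x. R (L x)) (u *\<^sub>R e) \<partial>lborel)"
  proof (rule nn_integral_cong)
    fix u
    have "(u *\<^sub>R e + (\<Sum>b\<in>Basis - {e}. y b *\<^sub>R b)) \<bullet> e = u" for y
      using e by (simp add: inner_add_left inner_sum_left inner_not_same_Basis)
    thus "partial_integral (Basis - {e}) (\<lambda>x. \<phi> (x \<bullet> e) * R (L x)) (u *\<^sub>R e)
        = \<phi> u * partial_integral (Basis - {e}) (\<lambda>x. R (L x)) (u *\<^sub>R e)"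
      unfolding partial_integral_def by (subst nn_integral_cmult[symmetric]) auto
  qed
  finally show ?thesis .
qed

text \<open>After disintegration both sides integrate the same even log-concave function of
  \<open>u\<close>, only against different weights. For \<open>v = 0\<close> both weights are
  constantly 1.\<close>

lemma gaussian_le_slab:
  fixes R :: "'a::euclidean_space \<Rightarrow> ennreal"
  assumes [measurable]: "R \<in> borel_measurable borel"
    and lc: "log_concave R" and ev: "\<And>x. R (- x) = R x" and C: "\<And>x. R x \<le> ennreal C"
    and N: "\<And>x b. b \<in> Basis \<Longrightarrow> R x \<noteq> 0 \<Longrightarrow> \<bar>x \<bullet> b\<bar> \<le> N"
  shows "(\<integral>\<^sup>+x. ennreal (exp (- (pi * (v \<bullet> x)\<^sup>2))) * R x \<partial>lborel)
    \<le> (\<integral>\<^sup>+x. indicator {-1/2<..<1/2} (v \<bullet> x) * R x \<partial>lborel)"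
proof (cases "v = 0")
  case False
  then obtain e where e: "e \<in> Basis" "v \<bullet> e \<noteq> 0" using euclidean_all_zero_iff by blast
  define L where "L = (\<lambda>x. (x - (x \<bullet> e) *\<^sub>R e) + ((x \<bullet> e - v \<bullet> (x - (x \<bullet> e) *\<^sub>R e)) / (v \<bullet> e)) *\<^sub>R e)"
  have [measurable]: "(\<lambda>x. R (L x)) \<in> borel_measurable borel" unfolding L_def by measurable
  have lin: "linear L" unfolding L_def
    by (rule linearI) (auto simp: algebra_simps inner_diff_right inner_add_right add_divide_distrib diff_divide_distrib)
  let ?H = "\<lambda>u. partial_integral (Basis - {e}) (\<lambda>x. R (L x)) (u *\<^sub>R e)"
  have "log_concave (partial_integral (Basis - {e}) (\<lambda>x. R (L x)))"
  proof (rule log_concave_partial_integral[where C = C and N = N])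
    show "log_concave (\<lambda>x. R (L x))" by (rule log_concave_linear_comp[OF lc lin])
    show "\<bar>p \<bullet> b\<bar> \<le> N" if b: "b \<in> Basis - {e}" and "R (L p) \<noteq> 0" for p b
    proof -
      have "e \<bullet> b = 0" using b e(1) by (intro inner_not_same_Basis) auto
      hence "L p \<bullet> b = p \<bullet> b" by (simp add: L_def inner_add_left inner_diff_left)
      thus ?thesis using N[of b "L p"] that by simp
    qed
  qed (use C in auto)
  hence lcH: "log_concave ?H" by (rule log_concave_linear_comp) (auto intro: linearI simp: algebra_simps)
  have evH: "?H (- u) = ?H u" for u
    using partial_integral_even[of "Basis - {e}" "\<lambda>x. R (L x)" "u *\<^sub>R e"] linear_neg[OF lin] ev by simp
  have [measurable]: "?H \<in> borel_measurable borel" by measurable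
  have "(\<integral>\<^sup>+u. ennreal (exp (- (pi * u\<^sup>2))) * ?H u \<partial>lborel) \<le> (\<integral>\<^sup>+u. indicator {-1/2<..<1/2} u * ?H u \<partial>lborel)"
    by (rule gaussian_le_interval) (use log_concave_even_antimono[OF lcH evH] in auto)
  thus ?thesis
    using nn_integral_slab_disintegration[OF e \<open>R \<in> _\<close>, of "\<lambda>u. ennreal (exp (- (pi * u\<^sup>2)))"]
      nn_integral_slab_disintegration[OF e \<open>R \<in> _\<close>, of "indicator {-1/2<..<1/2}"]
    by (simp add: L_def mult_left_mono)
qed simp

text \<open>The exponent is, up to sign, a sum of squares of linear forms and hence convex;
  convexity of \<open>X\<close> takes care of the indicator.\<close>

lemma log_concave_gaussian_on_convex:
  fixes v :: "'k \<Rightarrow> 'a::euclidean_space"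
  assumes "convex X"
  shows "log_concave (\<lambda>x. ennreal (indicator X x * exp (- (pi * (\<Sum>k\<in>K. (v k \<bullet> x)\<^sup>2)))))"
  unfolding log_concave_def
proof (intro allI impI, elim conjE)
  fix x y :: 'a and l a b :: real
  let ?r = "\<lambda>x. indicator X x * exp (- (pi * (\<Sum>k\<in>K. (v k \<bullet> x)\<^sup>2))) :: real"
  assume l: "0 < l" "l < 1" and ab: "0 \<le> a" "0 \<le> b" "ennreal a \<le> ennreal (?r x)" "ennreal b \<le> ennreal (?r y)"
  have a: "a \<le> ?r x" and b: "b \<le> ?r y" using ab by (auto simp: ennreal_le_iff)
  show "ennreal (a powr l * b powr (1 - l)) \<le> ennreal (?r (l *\<^sub>R x + (1 - l) *\<^sub>R y))"
  proof (cases "x \<in> X \<and> y \<in> X")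
    case False
    hence "a = 0 \<or> b = 0" using a b ab by (auto simp: indicator_def split: if_splits)
    thus ?thesis by auto
  next
    case True
    hence mem: "l *\<^sub>R x + (1 - l) *\<^sub>R y \<in> X" using assms l by (simp add: convex_def)
    have sq: "(v k \<bullet> (l *\<^sub>R x + (1 - l) *\<^sub>R y))\<^sup>2 \<le> l * (v k \<bullet> x)\<^sup>2 + (1 - l) * (v k \<bullet> y)\<^sup>2" for k
    proof -
      have "l * s\<^sup>2 + (1 - l) * t\<^sup>2 - (l * s + (1 - l) * t)\<^sup>2 = l * (1 - l) * (s - t)\<^sup>2" for s t :: real
        by (simp add: power2_eq_square algebra_simps)
      moreover have "0 \<le> l * (1 - l) * (v k \<bullet> x - v k \<bullet> y)\<^sup>2" using l by simp
      ultimately show ?thesis by (simp add: inner_add_right) (smt (verit))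
    qed
    have "a powr l * b powr (1 - l) \<le> ?r x powr l * ?r y powr (1 - l)"
      using ab a b l by (intro mult_mono powr_mono2) auto
    also have "\<dots> = exp (- (pi * (\<Sum>k\<in>K. l * (v k \<bullet> x)\<^sup>2 + (1 - l) * (v k \<bullet> y)\<^sup>2)))"
      using True by (simp add: powr_def sum.distrib flip: exp_add sum_distrib_left) (simp add: algebra_simps)
    also have "\<dots> \<le> exp (- (pi * (\<Sum>k\<in>K. (v k \<bullet> (l *\<^sub>R x + (1 - l) *\<^sub>R y))\<^sup>2)))"
      using sq by (simp add: sum_mono)
    finally show ?thesis using mem by (simp add: ennreal_leI)
  qed
qed

text \<open>Each exchanged slab is absorbed into the set, which therefore varies in the induction:
  \<open>Y\<close> is again convex, symmetric and bounded, and the factors not yet exchanged stay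
  Gaussian.\<close>

theorem Vaaler_gaussian_le_volume:
  fixes v :: "'k \<Rightarrow> 'a::euclidean_space"
  assumes "finite K" "convex X" "X \<in> sets borel" "\<And>x. x \<in> X \<Longrightarrow> - x \<in> X"
    and "\<And>x b. x \<in> X \<Longrightarrow> b \<in> Basis \<Longrightarrow> \<bar>x \<bullet> b\<bar> \<le> N"
  shows "(\<integral>\<^sup>+x. ennreal (indicator X x * exp (- (pi * (\<Sum>k\<in>K. (v k \<bullet> x)\<^sup>2)))) \<partial>lborel)
     \<le> emeasure lborel (X \<inter> {x. \<forall>k\<in>K. \<bar>v k \<bullet> x\<bar> < 1/2})"
  using assms
proof (induction K arbitrary: X rule: finite_induct)
  case empty
  thus ?case by (simp add: ennreal_indicator)
next
  case (insert k K)
  note [measurable] = insert.prems(2)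
  let ?R = "\<lambda>X x. ennreal (indicator X x * exp (- (pi * (\<Sum>k\<in>K. (v k \<bullet> x)\<^sup>2))))"
  define Y where "Y = X \<inter> {x. \<bar>v k \<bullet> x\<bar> < 1/2}"
  have [measurable]: "Y \<in> sets borel" unfolding Y_def by measurable
  have sym: "- x \<in> X \<longleftrightarrow> x \<in> X" for x using insert.prems(3) by (metis minus_minus)
  have Y: "Y = X \<inter> ({x. v k \<bullet> x < 1/2} \<inter> {x. v k \<bullet> x > -1/2})" by (auto simp: Y_def)
  have "(\<integral>\<^sup>+x. ennreal (indicator X x * exp (- (pi * (\<Sum>j\<in>insert k K. (v j \<bullet> x)\<^sup>2)))) \<partial>lborel)
    = (\<integral>\<^sup>+x. ennreal (exp (- (pi * (v k \<bullet> x)\<^sup>2))) * ?R X x \<partial>lborel)"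
  proof (rule nn_integral_cong)
    fix x
    have "exp (- (pi * (\<Sum>j\<in>insert k K. (v j \<bullet> x)\<^sup>2)))
        = exp (- (pi * (v k \<bullet> x)\<^sup>2)) * exp (- (pi * (\<Sum>j\<in>K. (v j \<bullet> x)\<^sup>2)))"
      using insert.hyps by (simp add: distrib_left flip: exp_add)
    thus "ennreal (indicator X x * exp (- (pi * (\<Sum>j\<in>insert k K. (v j \<bullet> x)\<^sup>2))))
        = ennreal (exp (- (pi * (v k \<bullet> x)\<^sup>2))) * ?R X x"
      by (simp add: mult_ac flip: ennreal_mult)
  qed
  also have "\<dots> \<le> (\<integral>\<^sup>+x. indicator {-1/2<..<1/2} (v k \<bullet> x) * ?R X x \<partial>lborel)"
  proof (rule gaussian_le_slab[where C = 1 and N = N])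
    show "log_concave (?R X)" by (rule log_concave_gaussian_on_convex) fact
    show "?R X (- x) = ?R X x" for x using sym by (simp add: indicator_def)
    show "?R X x \<le> ennreal 1" for x
      by (intro ennreal_leI) (auto simp: indicator_def sum_nonneg)
    show "\<bar>x \<bullet> b\<bar> \<le> N" if "b \<in> Basis" "?R X x \<noteq> 0" for x b
      using insert.prems(4)[of x b] that by (auto simp: indicator_def split: if_splits)
  qed measurable
  also have "\<dots> = (\<integral>\<^sup>+x. ?R Y x \<partial>lborel)"
    by (intro nn_integral_cong) (auto simp: Y_def indicator_def abs_less_iff)
  also have "\<dots> \<le> emeasure lborel (Y \<inter> {x. \<forall>k\<in>K. \<bar>v k \<bullet> x\<bar> < 1/2})"
  proof (rule insert.IH)
    show "convex Y" unfolding Y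
      by (intro convex_Int convex_halfspace_lt convex_halfspace_gt insert.prems)
  qed (use insert.prems in \<open>auto simp: Y_def\<close>)
  also have "Y \<inter> {x. \<forall>k\<in>K. \<bar>v k \<bullet> x\<bar> < 1/2} = X \<inter> {x. \<forall>j\<in>insert k K. \<bar>v j \<bullet> x\<bar> < 1/2}"
    by (auto simp: Y_def)
  finally show ?case .
qed

section \<open>Linear substitutions, Gaussian integrals and Blichfeldt's principle\<close>

lemma borel_measurable_matrix_vector_mult [measurable]:
  fixes A :: "real^'n^'m"
  shows "(\<lambda>x. A *v x) \<in> borel \<rightarrow>\<^sub>M borel"
  by (intro borel_measurable_continuous_onI linear_continuous_on linear_conv_bounded_linear[THEN iffD1] matrix_vector_mul_linear)

lemma nn_integral_transpose_coordinates:
  fixes f :: "real^'n \<Rightarrow> ennreal"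
  assumes [measurable]: "f \<in> borel_measurable borel" and p: "bij (p :: 'n \<Rightarrow> 'n)"
  shows "(\<integral>\<^sup>+x. f x \<partial>lborel) = (\<integral>\<^sup>+x. f (\<chi> i. x $ p i) \<partial>lborel)"
proof -
  let ?T = "\<lambda>x::real^'n. \<chi> i. x $ p i"
  let ?P = "inv p"
  have [measurable]: "?T \<in> borel \<rightarrow>\<^sub>M borel"
    by (intro borel_measurable_continuous_onI continuous_intros)
  have "lborel = distr lborel borel ?T"
  proof (rule lborel_eqI)
    fix l u :: "real^'n" assume le: "\<And>b. b \<in> Basis \<Longrightarrow> l \<bullet> b \<le> u \<bullet> b"
    have le': "l $ i \<le> u $ i" for i using le[of "axis i 1"] by (simp add: inner_axis)
    have pp: "p (?P i) = i" "?P (p i) = i" for i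
      using p by (auto simp: bij_is_surj surj_f_inv_f bij_is_inj)
    have vim: "?T -` box l u = box (\<chi> i. l $ ?P i) (\<chi> i. u $ ?P i)"
      unfolding box_def by (auto simp: mem_box_cart Basis_vec_def inner_axis) (metis pp)+
    have prod: "(\<Prod>b\<in>Basis. w \<bullet> b) = (\<Prod>i\<in>UNIV. w $ i)" for w :: "real^'n"
    proof -
      have B: "Basis = range (\<lambda>i. axis i 1 :: real^'n)" by (auto simp: Basis_vec_def)
      have "inj (\<lambda>i. axis i 1 :: real^'n)" by (auto simp: inj_on_def axis_eq_axis)
      thus ?thesis unfolding B by (subst prod.reindex) (auto simp: inner_axis)
    qed
    have "(\<Prod>i\<in>UNIV. u $ ?P i - l $ ?P i) = (\<Prod>i\<in>UNIV. u $ i - l $ i)"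
      by (rule prod.reindex_bij_betw) (use p in \<open>simp add: bij_imp_bij_inv\<close>)
    thus "emeasure (distr lborel borel ?T) (box l u) = (\<Prod>b\<in>Basis. (u - l) \<bullet> b)"
      using le' by (simp add: emeasure_distr vim emeasure_lborel_box_eq prod) (auto simp: Basis_vec_def inner_axis)
  qed simp
  hence "(\<integral>\<^sup>+x. f x \<partial>lborel) = (\<integral>\<^sup>+x. f x \<partial>distr lborel borel ?T)" by simp
  also have "\<dots> = (\<integral>\<^sup>+x. f (?T x) \<partial>lborel)" by (rule nn_integral_distr) measurable
  finally show ?thesis .
qed

text \<open>On every line in direction \<open>m\<close> the shear is a translation, because
  \<open>m \<noteq> n\<close> keeps coordinate \<open>n\<close> constant along the line.\<close>

lemma nn_integral_shear:
  fixes f :: "real^'n \<Rightarrow> ennreal"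
  assumes [measurable]: "f \<in> borel_measurable borel" and "m \<noteq> n"
  shows "(\<integral>\<^sup>+x. f x \<partial>lborel) = (\<integral>\<^sup>+x. f (x + (c * x $ n) *\<^sub>R axis m 1) \<partial>lborel)"
proof -
  let ?e = "axis m 1 :: real^'n"
  have e: "?e \<in> Basis" by (simp add: axis_in_Basis_iff)
  have "(\<integral>\<^sup>+t. f (q + t *\<^sub>R ?e) \<partial>lborel)
      = (\<integral>\<^sup>+t. f (q + t *\<^sub>R ?e + (c * (q + t *\<^sub>R ?e) $ n) *\<^sub>R ?e) \<partial>lborel)" for q
  proof -
    have "(\<integral>\<^sup>+t. f (q + t *\<^sub>R ?e) \<partial>lborel) = ennreal \<bar>1\<bar> * (\<integral>\<^sup>+t. f (q + (c * q $ n + 1 * t) *\<^sub>R ?e) \<partial>lborel)"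
      by (rule nn_integral_real_affine) auto
    thus ?thesis using assms(2) by (simp add: axis_def algebra_simps)
  qed
  thus ?thesis
    by (subst (1 2) nn_integral_split_direction[OF e]) (auto intro!: arg_cong2[where f = "partial_integral _"])
qed

text \<open>Both sides are multiplicative in \<open>T\<close>, so elementary matrices suffice. The
  case of a zero row is excluded by the determinant.\<close>

lemma nn_integral_linear:
  fixes T :: "real^'n^'n" and f :: "real^'n \<Rightarrow> ennreal"
  assumes "det T \<noteq> 0" "f \<in> borel_measurable borel"
  shows "(\<integral>\<^sup>+x. f x \<partial>lborel) = ennreal \<bar>det T\<bar> * (\<integral>\<^sup>+x. f (T *v x) \<partial>lborel)"
  using assms
proof (induction T arbitrary: f rule: induct_matrix_elementary)
  case (1 A B)
  note [measurable] = "1.prems"(2)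
  have d: "det A \<noteq> 0" "det B \<noteq> 0" using "1.prems" by (auto simp: det_mul)
  have "(\<integral>\<^sup>+x. f x \<partial>lborel) = ennreal \<bar>det A\<bar> * (\<integral>\<^sup>+x. f (A *v x) \<partial>lborel)" using 1 d by blast
  also have "(\<integral>\<^sup>+x. f (A *v x) \<partial>lborel) = ennreal \<bar>det B\<bar> * (\<integral>\<^sup>+x. f (A *v (B *v x)) \<partial>lborel)"
    by (rule "1.IH"(2)[OF d(2)]) measurable
  finally show ?case
    by (simp add: det_mul abs_mult ennreal_mult matrix_vector_mul_assoc mult.assoc)
next
  case (2 A i)
  thus ?case using det_zero_row(2) by blast
next
  case (3 A)
  note [measurable] = "3.prems"(2)
  define c where "c j = (A *v j) \<bullet> j" for j
  have ax: "Basis = range (\<lambda>i. axis i 1 :: real^'n)" "inj (\<lambda>i. axis i 1 :: real^'n)"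
    by (auto simp: Basis_vec_def inj_on_def axis_eq_axis)
  have cA: "c (axis i 1) = A $ i $ i" for i
    by (simp add: c_def inner_axis matrix_vector_mult_basis column_def)
  have det: "det A = (\<Prod>i\<in>UNIV. A $ i $ i)" by (rule det_diagonal) (use 3 in auto)
  have nz: "A $ i $ i \<noteq> 0" for i using "3.prems"(1) det by simp
  have T: "0 + (\<Sum>j\<in>Basis. (c j * (x \<bullet> j)) *\<^sub>R j) = A *v x" for x
  proof -
    have "(\<Sum>j\<in>Basis. (c j * (x \<bullet> j)) *\<^sub>R j) = (\<Sum>i\<in>UNIV. (A $ i $ i * x $ i) *\<^sub>R axis i 1)"
      by (simp add: ax sum.reindex cA inner_axis)
    also have "\<dots> = A *v x"
    proof (subst vec_eq_iff, rule allI)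
      fix k
      have "(A *v x) $ k = (\<Sum>j\<in>UNIV. if j = k then A $ k $ k * x $ k else 0)"
        unfolding matrix_vector_mult_def vec_lambda_beta using "3"(1) by (intro sum.cong) auto
      thus "(\<Sum>i\<in>UNIV. (A $ i $ i * x $ i) *\<^sub>R axis i 1) $ k = (A *v x) $ k"
        by (simp add: axis_def if_distrib cong: if_cong)
    qed
    finally show ?thesis by simp
  qed
  have "lborel = density (distr lborel borel (\<lambda>x. 0 + (\<Sum>j\<in>Basis. (c j * (x \<bullet> j)) *\<^sub>R j))) (\<lambda>_. (\<Prod>j\<in>Basis. \<bar>c j\<bar>))"
    by (rule lborel_affine_euclidean) (use nz in \<open>auto simp: ax cA\<close>)
  hence "lborel = density (distr lborel borel (\<lambda>x. A *v x)) (\<lambda>_. \<bar>det A\<bar>)"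
    unfolding T by (simp add: ax prod.reindex cA det abs_prod)
  hence "(\<integral>\<^sup>+x. f x \<partial>lborel) = (\<integral>\<^sup>+x. f x \<partial>density (distr lborel borel (\<lambda>x. A *v x)) (\<lambda>_. \<bar>det A\<bar>))" by simp
  also have "\<dots> = ennreal \<bar>det A\<bar> * (\<integral>\<^sup>+x. f (A *v x) \<partial>lborel)"
    by (simp add: nn_integral_density nn_integral_distr nn_integral_cmult)
  finally show ?case .
next
  case (4 m n)
  let ?A = "(\<chi> i j. mat 1 $ i $ Transposition.transpose m n j) :: real^'n^'n"
  have "?A *v x = (\<chi> i. x $ Transposition.transpose m n i)" for x
  proof (subst vec_eq_iff, rule allI)
    fix i
    have tr: "i = Transposition.transpose m n j \<longleftrightarrow> j = Transposition.transpose m n i" for j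
      by (metis transpose_involutory)
    have "(?A *v x) $ i = (\<Sum>j\<in>UNIV. if j = Transposition.transpose m n i then x $ j else 0)"
      unfolding matrix_vector_mult_def mat_def vec_lambda_beta by (intro sum.cong) (simp_all add: tr)
    thus "(?A *v x) $ i = (\<chi> i. x $ Transposition.transpose m n i) $ i" by simp
  qed
  moreover have "\<bar>det ?A\<bar> = 1"
    using det_permute_columns[of "Transposition.transpose m n" "mat 1 :: real^'n^'n"]
    by (simp add: permutes_swap_id sign_swap_id abs_mult)
  ultimately show ?case using nn_integral_transpose_coordinates[OF "4.prems"(2), of "Transposition.transpose m n"] by simp
next
  case (5 m n c)
  let ?A = "(\<chi> i j. if i = m \<and> j = n then c else of_bool (i = j)) :: real^'n^'n"
  have "?A *v x = x + (c * x $ n) *\<^sub>R axis m 1" for x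
  proof (subst vec_eq_iff, rule allI)
    fix i
    have "(?A *v x) $ i = (\<Sum>j\<in>UNIV. (if j = i then x $ j else 0) + (if j = n then (if i = m then c * x $ n else 0) else 0))"
      unfolding matrix_vector_mult_def using "5"(1) by (auto intro!: sum.cong)
    also have "\<dots> = x $ i + (if i = m then c * x $ n else 0)" by (subst sum.distrib) simp
    finally show "(?A *v x) $ i = (x + (c * x $ n) *\<^sub>R axis m 1) $ i" by (simp add: axis_def)
  qed
  moreover have "det ?A = 1"
  proof -
    have "?A = (\<chi> k. if k = m then row m (mat 1) + c *s row n (mat 1) else row k (mat 1))"
      using "5"(1) by (auto simp: vec_eq_iff row_def mat_def)
    thus ?thesis using det_row_operation[OF "5"(1), of "mat 1 :: real^'n^'n" c] by simp
  qed
  ultimately show ?case using nn_integral_shear[OF "5.prems"(2) "5"(1), of c] by simp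
qed

lemma nn_integral_gaussian_euclidean:
  "(\<integral>\<^sup>+x. ennreal (exp (- (pi * (norm x)\<^sup>2))) \<partial>(lborel :: 'a::euclidean_space measure)) = 1"
proof -
  have "(\<integral>\<^sup>+x. ennreal (exp (- (pi * (norm x)\<^sup>2))) \<partial>(lborel :: 'a measure))
      = (\<integral>\<^sup>+x. (\<Prod>b\<in>Basis. ennreal (exp (- (pi * (x \<bullet> b)\<^sup>2)))) \<partial>(lborel :: 'a measure))"
  proof (rule nn_integral_cong)
    fix x :: 'a
    have "(norm x)\<^sup>2 = (\<Sum>b\<in>Basis. (x \<bullet> b)\<^sup>2)"
      unfolding power2_norm_eq_inner by (subst euclidean_inner) (simp add: power2_eq_square)
    thus "ennreal (exp (- (pi * (norm x)\<^sup>2))) = (\<Prod>b\<in>Basis. ennreal (exp (- (pi * (x \<bullet> b)\<^sup>2))))"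
      by (simp add: prod_ennreal sum_distrib_left sum_negf[symmetric] exp_sum)
  qed
  also have "\<dots> = (\<Prod>b\<in>(Basis :: 'a set). (\<integral>\<^sup>+u. ennreal (exp (- (pi * u\<^sup>2))) \<partial>lborel))"
    by (rule nn_integral_lborel_prod) auto
  also have "\<dots> = 1" by (simp add: nn_integral_gaussian)
  finally show ?thesis .
qed

text \<open>Blichfeldt's principle: cut the set along the unit cubes of the integer lattice and translate
  all pieces into one cube, where they stay disjoint.\<close>

lemma emeasure_le_1_if_integer_translates_disjoint:
  fixes S :: "(real^'n) set"
  assumes [measurable]: "S \<in> sets borel"
    and inj: "\<And>x y. x \<in> S \<Longrightarrow> y \<in> S \<Longrightarrow> (\<And>i. x $ i - y $ i \<in> \<int>) \<Longrightarrow> x = y"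
  shows "emeasure lborel S \<le> 1"
proof -
  define r :: "int^'n \<Rightarrow> real^'n" where "r z = (\<chi> i. of_int (z $ i))" for z
  \<comment> \<open>The cube is half-open so that its integer translates tile the space. Tiling
    makes the pieces \<open>X z\<close> disjoint; the hypothesis on \<open>S\<close> makes their
    translates \<open>Y z\<close> inside \<open>Q\<close> disjoint.\<close>
  define Q :: "(real^'n) set" where "Q = {x. \<forall>i. 0 \<le> x $ i \<and> x $ i < 1}"
  have [measurable]: "Q \<in> sets borel" unfolding Q_def by measurable
  define X where "X z = S \<inter> {x. x - r z \<in> Q}" for z
  define Y where "Y z = {x. x + r z \<in> S} \<inter> Q" for z
  have X [measurable]: "X z \<in> sets borel" and Y [measurable]: "Y z \<in> sets borel" for z
    unfolding X_def Y_def by measurable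
  have XY: "emeasure lborel (X z) = emeasure lborel (Y z)" for z
  proof -
    have "emeasure lborel (X z) = emeasure (distr lborel borel ((+) (r z))) (X z)"
      by (simp add: lborel_distr_plus)
    also have "\<dots> = emeasure lborel (((+) (r z)) -` X z)" by (subst emeasure_distr) auto
    also have "((+) (r z)) -` X z = Y z" by (auto simp: X_def Y_def add.commute)
    finally show ?thesis .
  qed
  have S: "S = (\<Union>z. X z)"
  proof (intro equalityI subsetI)
    fix x assume x: "x \<in> S"
    have "x \<in> X (\<chi> i. \<lfloor>x $ i\<rfloor>)" using x by (auto simp: X_def Q_def r_def) linarith+
    thus "x \<in> (\<Union>z. X z)" by blast
  qed (auto simp: X_def)
  have floor: "z $ i = \<lfloor>x $ i\<rfloor>" if "x - r z \<in> Q" for x z i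
    using that by (simp add: Q_def r_def) (metis add.commute floor_unique le_diff_eq diff_less_eq add_0)
  have disjX: "disjoint_family X"
    unfolding disjoint_family_on_def X_def using floor by (auto simp: vec_eq_iff)
  have disjY: "disjoint_family Y"
    unfolding disjoint_family_on_def
  proof (intro ballI impI, rule ccontr)
    fix z w assume "z \<noteq> w" "Y z \<inter> Y w \<noteq> {}"
    then obtain x where x: "x + r z \<in> S" "x + r w \<in> S" by (auto simp: Y_def)
    have "x + r z = x + r w" by (rule inj[OF x]) (simp add: r_def)
    hence "z = w" by (simp add: r_def vec_eq_iff)
    thus False using \<open>z \<noteq> w\<close> by simp
  qed
  have "emeasure lborel S = (\<integral>\<^sup>+z. emeasure lborel (X z) \<partial>count_space UNIV)"
    unfolding S by (rule emeasure_UN_countable) (use disjX in auto)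
  also have "\<dots> = (\<integral>\<^sup>+z. emeasure lborel (Y z) \<partial>count_space UNIV)" by (simp add: XY)
  also have "\<dots> = emeasure lborel (\<Union>z. Y z)"
    by (rule emeasure_UN_countable[symmetric]) (use disjY in auto)
  also have "\<dots> \<le> emeasure lborel (cbox 0 (\<chi> i. 1) :: (real^'n) set)"
    by (rule emeasure_mono) (auto simp: Y_def Q_def mem_box_cart less_imp_le)
  also have "\<dots> = 1"
    by (subst emeasure_lborel_cbox) (auto intro!: prod.neutral simp: Basis_vec_def inner_axis)
  finally show ?thesis .
qed

section \<open>Orthonormal bases and determinants\<close>

text \<open>An orthonormal basis of the orthogonal complement is added; the dimension count then
  allows indexing by the coordinate type itself, so that the vectors form the rows of a square
  matrix.\<close>

lemma orthonormal_family_extension: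
  fixes F :: "(real^'n) set"
  assumes F: "pairwise orthogonal F" "\<And>x. x \<in> F \<Longrightarrow> norm x = 1"
  obtains u where "inj (u :: 'n \<Rightarrow> real^'n)" "F \<subseteq> range u" "\<And>i j. u i \<bullet> u j = (if i = j then 1 else 0)"
proof -
  define X where "X = {y \<in> (UNIV :: (real^'n) set). \<forall>x \<in> span F. orthogonal x y}"
  have X: "subspace X" unfolding X_def using subspace_orthogonal_to_vectors by simp
  have nzF: "0 \<notin> F" using F(2) by force
  have finF: "finite F" using F(1) by (rule pairwise_orthogonal_imp_finite)
  have indF: "independent F" using F(1) nzF by (rule pairwise_orthogonal_independent)
  obtain BX where BX: "BX \<subseteq> X" "pairwise orthogonal BX" "\<And>x. x \<in> BX \<Longrightarrow> norm x = 1"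
    "independent BX" "card BX = dim X" "span BX = X"
    using orthonormal_basis_subspace[OF X] by metis
  have cross: "x \<bullet> y = 0" if "x \<in> F" "y \<in> BX" for x y
    using that BX(1) span_base by (auto simp: X_def orthogonal_def)
  have disj: "F \<inter> BX = {}"
  proof (rule ccontr)
    assume "F \<inter> BX \<noteq> {}"
    then obtain x where "x \<in> F" "x \<in> BX" by auto
    thus False using cross[of x x] nzF by auto
  qed
  have finX: "finite BX" using BX(2) by (rule pairwise_orthogonal_imp_finite)
  have "dim X + dim (span F) = dim (UNIV :: (real^'n) set)"
    unfolding X_def by (rule dim_subspace_orthogonal_to_vectors) auto
  moreover have "dim (span F) = card F" using indF by (simp add: dim_eq_card_independent)
  ultimately have "card (F \<union> BX) = CARD('n)"
    using BX(5) card_Un_disjoint[OF finF finX disj] by simp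
  then obtain u where u: "bij_betw u (UNIV :: 'n set) (F \<union> BX)"
    using finite_same_card_bij[of "UNIV :: 'n set" "F \<union> BX"] finF finX by auto
  have inj: "inj u" and ran: "range u = F \<union> BX" using u by (auto simp: bij_betw_def)
  have "u i \<bullet> u j = (if i = j then 1 else 0)" for i j
  proof (cases "i = j")
    case True
    have "norm (u i) = 1" using ran F(2) BX(3) by (metis Un_iff rangeI)
    thus ?thesis using True by (simp add: dot_square_norm)
  next
    case False
    hence ne: "u i \<noteq> u j" using inj by (auto simp: inj_def)
    have "u i \<in> F \<union> BX" "u j \<in> F \<union> BX" using ran by auto
    moreover have "x \<bullet> y = 0" if "x \<in> BX" "y \<in> F" for x y using cross[OF that(2,1)] by (simp add: inner_commute)
    ultimately show ?thesis using False ne cross F(1) BX(2)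
      by (auto simp: pairwise_def orthogonal_def)
  qed
  thus ?thesis using that inj ran by blast
qed

text \<open>The matrix is block diagonal, with \<open>C\<close> transported along \<open>e\<close>
  and the diagonal \<open>d\<close> elsewhere. In the Leibniz sum only permutations fixing every
  index outside \<open>range e\<close> survive, and these correspond, with equal sign, to
  permutations of the small index type.\<close>

lemma det_block_embedding:
  fixes C :: "'a::comm_ring_1^'m^'m" and e :: "'m \<Rightarrow> 'n::finite" and d :: "'n \<Rightarrow> 'a"
  assumes e: "inj e"
  shows "det (\<chi> j i. if j \<in> range e then (if i \<in> range e then C $ inv e j $ inv e i else 0)
              else if i = j then d j else 0) = (\<Prod>j\<in>- range e. d j) * det C" (is "det ?N = _")
proof -
  let ?f = "map_permutation UNIV e"
  let ?g = "\<lambda>p. of_int (sign p) * (\<Prod>j\<in>UNIV. ?N $ j $ p j)"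
  have bij: "bij_betw e UNIV (range e)" using e by (simp add: bij_betw_def)
  have img: "?f ` {p. p permutes UNIV} = {p. p permutes range e}"
  proof (intro equalityI subsetI)
    fix p assume "p \<in> {p. p permutes range e}"
    hence p: "p permutes range e" by simp
    have fa: "p (e x) = e (inv e (p (e x)))" for x
      using p by (metis f_inv_into_f permutes_in_image rangeI)
    let ?q = "\<lambda>x. inv e (p (e x))"
    have "inj ?q" 
    proof (rule injI)
      fix x y assume "?q x = ?q y"
      hence "p (e x) = p (e y)" using fa by metis
      thus "x = y" using permutes_inj[OF p] e by (auto simp: inj_def)
    qed
    hence "bij ?q" using finite_UNIV_inj_surj[of ?q] by (simp add: bij_def)
    hence q: "?q permutes UNIV" by (intro bij_imp_permutes) auto
    have "?f ?q y = p y" for y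
    proof (cases "y \<in> range e")
      case True
      thus ?thesis using fa by (auto simp: map_permutation_apply[OF e])
    next
      case False
      thus ?thesis using p map_permutation_permutes[OF bij q] by (simp add: permutes_not_in)
    qed
    thus "p \<in> ?f ` {p. p permutes UNIV}" using q by (intro image_eqI[of _ _ ?q]) auto
  qed (use map_permutation_permutes[OF bij] in auto)
  have injf: "inj_on ?f {p. p permutes UNIV}"
  proof (rule inj_onI, rule ext)
    fix p q x assume "?f p = ?f q"
    hence "?f p (e x) = ?f q (e x)" by simp
    thus "p x = q x" using e by (simp add: map_permutation_apply inj_eq)
  qed
  have zero: "?g p = 0" if p: "p permutes UNIV" and n: "\<not> p permutes range e" for p
  proof -
    have "\<exists>j. j \<notin> range e \<and> p j \<noteq> j"
    proof (rule ccontr)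
      assume "\<not> (\<exists>j. j \<notin> range e \<and> p j \<noteq> j)"
      hence "p permutes range e" using p unfolding permutes_def by blast
      thus False using n by simp
    qed
    then obtain j where "j \<notin> range e" "p j \<noteq> j" by blast
    hence "?N $ j $ p j = 0" by simp
    hence "(\<Prod>j\<in>UNIV. ?N $ j $ p j) = 0" by (meson UNIV_I finite prod_zero)
    thus ?thesis by simp
  qed
  have val: "?g (?f q) = (\<Prod>j\<in>- range e. d j) * (of_int (sign q) * (\<Prod>k\<in>UNIV. C $ k $ q k))"
    if q: "q permutes UNIV" for q
  proof -
    have p: "?f q permutes range e" by (rule map_permutation_permutes[OF bij q])
    have "(\<Prod>j\<in>UNIV. ?N $ j $ ?f q j) = (\<Prod>j\<in>range e. ?N $ j $ ?f q j) * (\<Prod>j\<in>- range e. ?N $ j $ ?f q j)"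
      by (subst prod.union_disjoint[symmetric]) (auto simp: Un_commute)
    also have "(\<Prod>j\<in>range e. ?N $ j $ ?f q j) = (\<Prod>k\<in>UNIV. C $ k $ q k)"
      using e by (subst prod.reindex) (auto simp: map_permutation_apply)
    also have "(\<Prod>j\<in>- range e. ?N $ j $ ?f q j) = (\<Prod>j\<in>- range e. d j)"
      using p by (intro prod.cong) (auto simp: permutes_not_in)
    finally show ?thesis using sign_map_permutation[OF e q] by (simp add: mult_ac)
  qed
  have "det ?N = sum ?g {p. p permutes UNIV}" by (simp only: det_def)
  also have "\<dots> = sum ?g {p. p permutes range e}"
    by (rule sum.mono_neutral_right) (use zero in \<open>auto intro: permutes_subset\<close>)
  also have "\<dots> = (\<Sum>q\<in>{p. p permutes UNIV}. ?g (?f q))"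
    unfolding img[symmetric] by (rule sum.reindex[OF injf, unfolded o_def])
  also have "\<dots> = (\<Sum>q\<in>{p. p permutes UNIV}. (\<Prod>j\<in>- range e. d j) * (of_int (sign q) * (\<Prod>k\<in>UNIV. C $ k $ q k)))"
    by (rule sum.cong[OF refl], rule val) simp
  also have "\<dots> = (\<Prod>j\<in>- range e. d j) * det C" by (simp only: det_def sum_distrib_left)
  finally show ?thesis .
qed

text \<open>A vector \<open>y\<close> killed by the Gram matrix is killed by the transpose of
  \<open>M\<close>, being of norm 0 there; surjectivity gives \<open>y = M *v x\<close>, and then
  \<open>y \<bullet> y = 0\<close>.\<close>

lemma det_gram_nonzero:
  fixes M :: "real^'n^'m"
  assumes "rank M = CARD('m)"
  shows "det (M ** transpose M) \<noteq> 0"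
proof
  assume "det (M ** transpose M) = 0"
  then obtain y where y: "y \<noteq> 0" "(M ** transpose M) *v y = 0"
    using matrix_left_invertible_ker invertible_left_inverse invertible_det_nz by metis
  have "(transpose M *v y) \<bullet> (transpose M *v y) = y \<bullet> (M *v (transpose M *v y))"
    by (metis dot_lmul_matrix transpose_matrix_vector)
  also have "\<dots> = 0" unfolding matrix_vector_mul_assoc y by simp
  finally have 0: "transpose M *v y = 0" by (simp only: inner_eq_zero_iff)
  obtain x where "y = M *v x" using assms full_rank_surjective[of M] by (metis surjD)
  hence "y \<bullet> y = (transpose M *v y) \<bullet> x" by (metis dot_lmul_matrix transpose_matrix_vector)
  thus False using 0 y by simp
qed

text \<open>The kernel has codimension \<open>rank M\<close>, so it meets the coordinate subspace of
  dimension \<open>card S\<close> in codimension at most \<open>rank M\<close>.\<close>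

lemma card_le_dim_kernel_on_coordinates:
  fixes M :: "real^'n^'m"
  shows "card S \<le> dim {x. M *v x = 0 \<and> (\<forall>i. i \<notin> S \<longrightarrow> x $ i = 0)} + rank M"
proof -
  let ?V = "{x :: real^'n. \<forall>i. i \<notin> S \<longrightarrow> x $ i = 0}" and ?K = "{x. M *v x = 0}"
  have V: "subspace ?V" by (auto simp: subspace_def)
  have K: "subspace ?K" by (auto simp: subspace_def matrix_vector_right_distrib matrix_vector_mult_scaleR)
  have Keq: "?K = {y \<in> UNIV. \<forall>x \<in> span (rows M). orthogonal x y}"
  proof -
    have "M *v y = 0 \<longleftrightarrow> (\<forall>x \<in> rows M. orthogonal x y)" for y
    proof -
      have "rows M = range (($) M)" by (auto simp: rows_def row_def vec_lambda_eta)
      thus ?thesis by (simp add: vec_eq_iff[of "M *v y"] matrix_vector_mul_component orthogonal_def)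
    qed
    moreover have "(\<forall>x \<in> span (rows M). orthogonal x y) \<longleftrightarrow> (\<forall>x \<in> rows M. orthogonal x y)" for y
      by (meson orthogonal_commute orthogonal_to_span span_base)
    ultimately show ?thesis by blast
  qed
  have "dim ?K + dim (span (rows M)) = dim (UNIV :: (real^'n) set)"
    unfolding Keq by (rule dim_subspace_orthogonal_to_vectors) auto
  hence 1: "dim ?K + rank M = CARD('n)" by (simp add: row_rank_def)
  have 2: "dim ?V = card S" using dim_substandard_cart[of S, where 'a = real] by (simp add: dim_vec_eq)
  have "dim {x + y |x y. x \<in> ?V \<and> y \<in> ?K} + dim (?V \<inter> ?K) = dim ?V + dim ?K"
    by (rule dim_sums_Int[OF V K])
  moreover have "dim {x + y |x y. x \<in> ?V \<and> y \<in> ?K} \<le> CARD('n)" by (rule dim_subset_UNIV_cart)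
  moreover have "?V \<inter> ?K = {x. M *v x = 0 \<and> (\<forall>i. i \<notin> S \<longrightarrow> x $ i = 0)}" by auto
  ultimately show ?thesis using 1 2 by simp
qed

lemma orthonormal_family_expansion:
  fixes u :: "'n \<Rightarrow> real^'n"
  assumes u: "\<And>i j. u i \<bullet> u j = (if i = j then 1 else 0)"
  shows "x = (\<Sum>j\<in>UNIV. (u j \<bullet> x) *\<^sub>R u j)" and "\<bar>det (\<chi> j. u j)\<bar> = 1"
proof -
  let ?U = "(\<chi> j. u j) :: real^'n^'n"
  have "?U ** transpose ?U = mat 1"
    by (simp add: vec_eq_iff matrix_matrix_mult_def transpose_def mat_def inner_vec_def[symmetric] u[unfolded inner_vec_def, simplified])
  hence O: "orthogonal_matrix ?U" unfolding orthogonal_matrix_def using matrix_left_right_inverse by blast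
  show "\<bar>det ?U\<bar> = 1" using det_orthogonal_matrix[OF O] by auto
  have "x = (transpose ?U ** ?U) *v x" using O by (simp add: orthogonal_matrix_def)
  also have "\<dots> = transpose ?U *v (?U *v x)" by (simp only: matrix_vector_mul_assoc)
  also have "\<dots> = (\<Sum>j\<in>UNIV. (u j \<bullet> x) *\<^sub>R u j)"
    by (simp add: vec_eq_iff matrix_vector_mult_def transpose_def inner_vec_def mult.commute del: transpose_matrix_vector)
  finally show "x = (\<Sum>j\<in>UNIV. (u j \<bullet> x) *\<^sub>R u j)" .
qed

lemma norm_sum_orthonormal:
  fixes u :: "'n::finite \<Rightarrow> 'a::real_inner"
  assumes u: "\<And>i j. u i \<bullet> u j = (if i = j then 1 else 0)"
  shows "(norm (\<Sum>j\<in>J. a j *\<^sub>R u j))\<^sup>2 = (\<Sum>j\<in>J. (a j)\<^sup>2)"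
proof -
  have "(\<Sum>j\<in>J. a j *\<^sub>R u j) \<bullet> (\<Sum>j\<in>J. a j *\<^sub>R u j) = (\<Sum>i\<in>J. \<Sum>j\<in>J. a i * a j * (u i \<bullet> u j))"
    by (simp add: inner_sum_left inner_sum_right sum_distrib_left mult_ac inner_commute)
  also have "\<dots> = (\<Sum>i\<in>J. (a i)\<^sup>2)"
    by (rule sum.cong) (auto simp: u power2_eq_square if_distrib cong: if_cong)
  finally show ?thesis by (simp add: power2_norm_eq_inner)
qed

text \<open>With respect to an orthonormal basis adapted to the kernel vectors supported on \<open>S\<close>, the rest
  of the kernel, and the row space, \<open>T\<close> is block diagonal with blocks \<open>1/2\<close>, \<open>1\<close> and the matrix of \<open>M\<close> on
  its row space, while \<open>P\<close> is the orthogonal projection onto the kernel of \<open>M\<close>.\<close>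

lemma adapted_transformation:
  fixes M :: "real^'n^'m" and S :: "'n set"
  defines "w \<equiv> \<lambda>i. if i \<in> S then 1/2 else 1 :: real"
  assumes rk: "rank M = CARD('m)"
  obtains T P :: "real^'n^'n" where
    "\<And>x. M *v x = 0 \<Longrightarrow> P *v x = x"
    "\<And>x. (\<Sum>i\<in>UNIV. (w i * (P *v x) $ i)\<^sup>2) + (norm (M *v x))\<^sup>2 \<le> (norm (T *v x))\<^sup>2"
    "det T \<noteq> 0" "2 ^ card S * \<bar>det T\<bar> \<le> 2 ^ CARD('m) * sqrt (det (M ** transpose M))"
proof -
  let ?U = "{x. M *v x = 0 \<and> (\<forall>i. i \<notin> S \<longrightarrow> x $ i = 0)}"
  have subU: "subspace ?U"
    by (auto simp: subspace_def matrix_vector_right_distrib matrix_vector_mult_scaleR)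
  obtain BU where BU: "BU \<subseteq> ?U" "pairwise orthogonal BU" "\<And>x. x \<in> BU \<Longrightarrow> norm x = 1"
    "independent BU" "card BU = dim ?U" "span BU = ?U"
    by (rule orthonormal_basis_subspace[OF subU], rule that)
  obtain BW where BW: "BW \<subseteq> span (rows M)" "pairwise orthogonal BW" "\<And>x. x \<in> BW \<Longrightarrow> norm x = 1"
    "independent BW" "card BW = dim (span (rows M))" "span BW = span (rows M)"
    by (rule orthonormal_basis_subspace[OF subspace_span[of "rows M"]], rule that)
  have rows: "M $ k \<in> span (rows M)" for k
    by (rule span_base) (auto simp: rows_def row_def vec_lambda_eta)
  have kerW: "x \<bullet> y = 0" if "M *v x = 0" "y \<in> span (rows M)" for x y
  proof -
    have "orthogonal x z" if z: "z \<in> rows M" for z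
    proof -
      have "rows M = range (($) M)" by (auto simp: rows_def row_def vec_lambda_eta)
      then obtain k where "z = M $ k" using z by auto
      moreover have "(M *v x) $ k = 0" using \<open>M *v x = 0\<close> by simp
      ultimately show ?thesis by (simp add: matrix_vector_mul_component orthogonal_def inner_commute)
    qed
    thus ?thesis using that(2) orthogonal_to_span by (metis orthogonal_def)
  qed
  have UW: "x \<bullet> y = 0" if "x \<in> BU" "y \<in> BW" for x y using that BU(1) BW(1) kerW by blast
  have po: "pairwise orthogonal (BU \<union> BW)"
    using BU(2) BW(2) UW
    unfolding pairwise_def orthogonal_def by (metis Un_iff inner_commute)
  have pn: "norm x = 1" if "x \<in> BU \<union> BW" for x using that BU(3) BW(3) by auto
  obtain u where injo: "inj (u :: 'n \<Rightarrow> real^'n)" and ran: "BU \<union> BW \<subseteq> range u"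
    and u: "\<And>i j. u i \<bullet> u j = (if i = j then 1 else 0)"
    by (rule orthonormal_family_extension[OF po pn], assumption, rule that)
  have finW: "finite BW" using BW(2) by (rule pairwise_orthogonal_imp_finite)
  have "card BW = CARD('m)" using BW(5) rk by (simp add: row_rank_def)
  then obtain q where q: "bij_betw q (UNIV :: 'm set) BW"
    using finite_same_card_bij[of "UNIV :: 'm set" BW] finW by auto
  define e where "e k = inv u (q k)" for k
  have qW: "q k \<in> BW" for k using q by (auto simp: bij_betw_def)
  have ue: "u (e k) = q k" for k unfolding e_def using qW ran by (intro f_inv_into_f) auto
  have inje: "inj e"
  proof (rule injI)
    fix x y assume "e x = e y"
    hence "q x = q y" using ue by metis
    thus "x = y" using q by (auto simp: bij_betw_def inj_def)
  qed
  have rane: "j \<in> range e \<longleftrightarrow> u j \<in> BW" for j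
  proof
    assume "u j \<in> BW"
    then obtain k where "u j = q k" using q by (auto simp: bij_betw_def)
    hence "j = e k" using ue injo by (metis injD)
    thus "j \<in> range e" by simp
  qed (use ue qW in auto)
  \<comment> \<open>\<open>D\<close> indexes the kernel vectors supported on \<open>S\<close>,
    \<open>R\<close> the rest of the kernel, and \<open>range e\<close> the row space.\<close>
  define D where "D = {j. u j \<in> BU}"
  define R where "R = - range e - D"
  have Dint: "D \<inter> range e = {}"
  proof (rule ccontr)
    assume "D \<inter> range e \<noteq> {}"
    then obtain j where "u j \<in> BU" "u j \<in> BW" using rane by (auto simp: D_def)
    thus False using UW u[of j j] by fastforce
  qed
  have cardD: "card D = dim ?U"
  proof -
    have "u ` D = BU" unfolding D_def using ran by auto
    thus ?thesis using BU(5) injo by (metis card_image inj_on_subset subset_UNIV)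
  qed
  have off: "u j \<bullet> y = 0" if "j \<notin> range e" "y \<in> span (rows M)" for j y
  proof -
    have "orthogonal (u j) z" if z: "z \<in> BW" for z
    proof -
      obtain k where "z = u (e k)" using z q ue by (metis bij_betw_imp_surj_on imageE)
      thus ?thesis using u[of j "e k"] \<open>j \<notin> range e\<close> by (auto simp: orthogonal_def)
    qed
    thus ?thesis using that(2) BW(6) orthogonal_to_span by (metis orthogonal_def)
  qed
  \<comment> \<open>In the row space basis \<open>M\<close> becomes a square matrix, so its Gram
    determinant is the square of a determinant.\<close>
  define C :: "real^'m^'m" where "C = (\<chi> k i. M $ k \<bullet> u (e i))"
  have Mk: "M $ k = (\<Sum>i\<in>UNIV. C $ k $ i *\<^sub>R u (e i))" for k
  proof -
    have "M $ k = (\<Sum>j\<in>UNIV. (u j \<bullet> M $ k) *\<^sub>R u j)" by (rule orthonormal_family_expansion(1)[OF u])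
    also have "\<dots> = (\<Sum>j\<in>range e. (u j \<bullet> M $ k) *\<^sub>R u j)"
      by (rule sum.mono_neutral_right) (use off rows in auto)
    also have "\<dots> = (\<Sum>i\<in>UNIV. C $ k $ i *\<^sub>R u (e i))"
      using inje by (subst sum.reindex) (auto simp: C_def inner_commute)
    finally show ?thesis .
  qed
  have Mx: "(M *v x) $ k = (\<Sum>i\<in>UNIV. C $ k $ i * (u (e i) \<bullet> x))" for k x
    by (subst matrix_vector_mul_component, subst Mk) (simp add: inner_sum_left)
  have gram: "M ** transpose M = C ** transpose C"
  proof (subst vec_eq_iff, rule allI, subst vec_eq_iff, rule allI)
    fix k l
    have "(M ** transpose M) $ k $ l = (M *v (M $ l)) $ k"
      by (simp add: matrix_matrix_mult_def transpose_def matrix_vector_mult_def)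
    also have "\<dots> = (\<Sum>i\<in>UNIV. C $ k $ i * C $ l $ i)"
      unfolding Mx by (simp add: C_def inner_commute)
    finally show "(M ** transpose M) $ k $ l = (C ** transpose C) $ k $ l"
      by (simp add: matrix_matrix_mult_def transpose_def)
  qed
  have detC: "sqrt (det (M ** transpose M)) = \<bar>det C\<bar>"
    unfolding gram by (simp add: det_mul det_transpose)
  have detC0: "det C \<noteq> 0"
    using det_gram_nonzero[OF rk] unfolding gram by (simp add: det_mul det_transpose)
  define d where "d j = (if j \<in> D then 1/2 else 1 :: real)" for j
  define N :: "real^'n^'n" where "N = (\<chi> j i. if j \<in> range e then (if i \<in> range e then C $ inv e j $ inv e i else 0)
              else if i = j then d j else 0)"
  define T where "T = N ** (\<chi> j. u j)"
  have "(\<Prod>j\<in>- range e. d j) = (1/2) ^ card D"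
  proof -
    have "(\<Prod>j\<in>- range e. d j) = (\<Prod>j\<in>D. d j)"
      by (rule prod.mono_neutral_right) (use Dint in \<open>auto simp: d_def\<close>)
    thus ?thesis by (simp add: d_def)
  qed
  hence "det N = (1/2) ^ card D * det C"
    unfolding N_def by (simp only: det_block_embedding[OF inje])
  hence detT: "\<bar>det T\<bar> = (1/2) ^ card D * \<bar>det C\<bar>"
    using orthonormal_family_expansion(2)[of u, OF u] by (simp add: T_def det_mul abs_mult power_abs)
  have "2 ^ card S * \<bar>det T\<bar> \<le> 2 ^ (card D + CARD('m)) * \<bar>det T\<bar>"
    using card_le_dim_kernel_on_coordinates[of S M] cardD rk
    by (intro mult_right_mono power_increasing) auto
  also have "\<dots> = 2 ^ CARD('m) * sqrt (det (M ** transpose M))"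
    unfolding detC detT by (simp add: power_add power_divide)
  finally have bound: "2 ^ card S * \<bar>det T\<bar> \<le> 2 ^ CARD('m) * sqrt (det (M ** transpose M))" .
  define Pf where "Pf x = (\<Sum>j\<in>- range e. (u j \<bullet> x) *\<^sub>R u j)" for x
  have "linear Pf" unfolding Pf_def
    by (rule linearI) (simp_all add: inner_add_right scaleR_add_left sum.distrib scaleR_sum_right)
  hence P: "matrix Pf *v x = Pf x" for x by (simp add: matrix_works linear_matrix_vector_mul_eq)
  show ?thesis
  proof (rule that)
    fix x assume x: "M *v x = 0"
    have "x = (\<Sum>j\<in>UNIV. (u j \<bullet> x) *\<^sub>R u j)" by (rule orthonormal_family_expansion(1)[OF u])
    also have "\<dots> = Pf x" unfolding Pf_def
    proof (rule sum.mono_neutral_right)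
      show "\<forall>j\<in>UNIV - - range e. (u j \<bullet> x) *\<^sub>R u j = 0"
      proof
        fix j assume "j \<in> UNIV - - range e"
        hence "u j \<in> span (rows M)" using rane BW(1) by auto
        hence "x \<bullet> u j = 0" using kerW[OF x] by blast
        thus "(u j \<bullet> x) *\<^sub>R u j = 0" by (simp add: inner_commute)
      qed
    qed auto
    finally show "matrix Pf *v x = x" by (simp add: P)
  next
    fix x
    define a where "a = (\<Sum>j\<in>D. (u j \<bullet> x) *\<^sub>R u j)"
    define b where "b = (\<Sum>j\<in>R. (u j \<bullet> x) *\<^sub>R u j)"
    have split: "- range e = D \<union> R" "D \<inter> R = {}" using Dint by (auto simp: R_def)
    have Pab: "Pf x = a + b"
      unfolding Pf_def a_def b_def split(1) by (rule sum.union_disjoint) (use split in auto)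
    have na: "(norm a)\<^sup>2 = (\<Sum>j\<in>D. (u j \<bullet> x)\<^sup>2)" and nb: "(norm b)\<^sup>2 = (\<Sum>j\<in>R. (u j \<bullet> x)\<^sup>2)"
      unfolding a_def b_def by (rule norm_sum_orthonormal[OF u])+
    have "(norm (Pf x))\<^sup>2 = (\<Sum>j\<in>D \<union> R. (u j \<bullet> x)\<^sup>2)"
      unfolding Pf_def split(1) by (rule norm_sum_orthonormal[OF u])
    also have "\<dots> = (norm a)\<^sup>2 + (norm b)\<^sup>2"
      unfolding na nb by (rule sum.union_disjoint) (use split in auto)
    finally have nab: "(norm (a + b))\<^sup>2 = (norm a)\<^sup>2 + (norm b)\<^sup>2" by (simp add: Pab)
    have "a \<in> ?U" unfolding a_def BU(6)[symmetric]
      by (intro span_sum span_scale span_base) (auto simp: D_def)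
    hence a0: "a $ i = 0" if "i \<notin> S" for i using that by simp
    have nv: "(norm v)\<^sup>2 = (\<Sum>i\<in>UNIV. (v $ i)\<^sup>2)" for v :: "real^'k"
      unfolding power2_norm_eq_inner by (simp add: inner_vec_def power2_eq_square)
    \<comment> \<open>On \<open>S\<close> the weight already gives the quarter; off \<open>S\<close>
      the entry of \<open>a\<close> vanishes, so the square is that of \<open>b\<close>, split as
      1/4 plus 3/4. Orthogonality of \<open>a\<close> and \<open>b\<close> then produces the
      coefficients 1/4 and 1 of \<open>T\<close>.\<close>
    have "(\<Sum>i\<in>UNIV. (w i * (a + b) $ i)\<^sup>2) \<le> (\<Sum>i\<in>UNIV. ((a + b) $ i)\<^sup>2 / 4 + 3/4 * (b $ i)\<^sup>2)"
      by (rule sum_mono) (simp add: w_def a0 power_divide)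
    also have "\<dots> = (norm (a + b))\<^sup>2 / 4 + 3/4 * (norm b)\<^sup>2"
      unfolding nv by (simp add: sum.distrib sum_divide_distrib sum_distrib_left)
    also have "\<dots> = (norm a)\<^sup>2 / 4 + (norm b)\<^sup>2" unfolding nab by (simp add: field_simps)
    finally have Pbound: "(\<Sum>i\<in>UNIV. (w i * (matrix Pf *v x) $ i)\<^sup>2) \<le> (norm a)\<^sup>2 / 4 + (norm b)\<^sup>2"
      by (simp only: P Pab)
    define y where "y = (\<chi> j. u j) *v x"
    have y: "y $ j = u j \<bullet> x" for j by (simp add: y_def matrix_vector_mul_component)
    have Tx: "T *v x = N *v y" by (simp only: T_def y_def matrix_vector_mul_assoc)
    have N1: "(N *v y) $ e k = (M *v x) $ k" for k
    proof -
      have "(N *v y) $ e k = (\<Sum>i\<in>UNIV. (if i \<in> range e then C $ k $ inv e i * y $ i else 0))"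
        unfolding matrix_vector_mult_def N_def using inje by (auto intro!: sum.cong)
      also have "\<dots> = (\<Sum>i\<in>range e. C $ k $ inv e i * y $ i)"
        by (rule sum.mono_neutral_cong_right) auto
      also have "\<dots> = (M *v x) $ k"
        unfolding Mx using inje by (subst sum.reindex) (auto simp: y)
      finally show ?thesis .
    qed
    have N2: "(N *v y) $ j = d j * (u j \<bullet> x)" if "j \<notin> range e" for j
    proof -
      have "(N *v y) $ j = (\<Sum>i\<in>UNIV. if i = j then d j * y $ i else 0)"
        unfolding matrix_vector_mult_def N_def vec_lambda_beta using that by (intro sum.cong) auto
      thus ?thesis by (simp add: y)
    qed
    have "(norm (T *v x))\<^sup>2 = (\<Sum>j\<in>range e. ((N *v y) $ j)\<^sup>2) + (\<Sum>j\<in>- range e. ((N *v y) $ j)\<^sup>2)"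
      unfolding Tx nv by (subst sum.union_disjoint[symmetric]) (auto simp: Un_commute)
    also have "(\<Sum>j\<in>range e. ((N *v y) $ j)\<^sup>2) = (norm (M *v x))\<^sup>2"
      unfolding nv using inje by (subst sum.reindex) (auto simp: N1)
    also have "(\<Sum>j\<in>- range e. ((N *v y) $ j)\<^sup>2) = (\<Sum>j\<in>- range e. (d j * (u j \<bullet> x))\<^sup>2)"
      by (rule sum.cong) (auto simp: N2)
    also have "\<dots> = (\<Sum>j\<in>D. (d j * (u j \<bullet> x))\<^sup>2) + (\<Sum>j\<in>R. (d j * (u j \<bullet> x))\<^sup>2)"
      unfolding split(1) by (rule sum.union_disjoint) (use split in auto)
    also have "(\<Sum>j\<in>D. (d j * (u j \<bullet> x))\<^sup>2) = (norm a)\<^sup>2 / 4"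
      unfolding na sum_divide_distrib by (rule sum.cong) (auto simp: d_def power_divide)
    also have "(\<Sum>j\<in>R. (d j * (u j \<bullet> x))\<^sup>2) = (norm b)\<^sup>2"
      unfolding nb by (rule sum.cong) (auto simp: d_def R_def)
    finally show "(\<Sum>i\<in>UNIV. (w i * (matrix Pf *v x) $ i)\<^sup>2) + (norm (M *v x))\<^sup>2 \<le> (norm (T *v x))\<^sup>2"
      using Pbound by simp
  next
    show "det T \<noteq> 0" using detT detC0 by auto
  qed (rule bound)
qed

section \<open>Small vectors in the kernel lattice\<close>

abbreviation (input) real_matrix :: "int^'n^'m \<Rightarrow> real^'n^'m" where
  "real_matrix \<equiv> map_matrix real_of_int"

text \<open>The Gaussian composed with \<open>T\<close> has integral
  \<open>1 / \<bar>det T\<bar>\<close> and is dominated by the volume of the slab set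
  \<open>Z\<close>, which is at most 1. Hence \<open>\<bar>det T\<bar> \<ge> 1\<close>, and the
  determinant bound for \<open>T\<close> finishes.\<close>

lemma card_support_le_gram_primitive:
  fixes B :: "int^'n^'m"
  assumes rk: "rank (real_matrix B) = CARD('m)"
    and small: "\<And>y :: int^'n. B *v y = 0 \<Longrightarrow> (\<And>i. \<bar>y $ i\<bar> \<le> 1) \<Longrightarrow> (\<And>i. i \<notin> S \<Longrightarrow> y $ i = 0) \<Longrightarrow> y = 0"
  shows "2 ^ card S \<le> 2 ^ CARD('m) * sqrt (det (real_matrix B ** transpose (real_matrix B)))"
proof -
  let ?M = "real_matrix B"
  obtain T P :: "real^'n^'n" where PT: 
    "\<And>x. ?M *v x = 0 \<Longrightarrow> P *v x = x"
    "\<And>x. (\<Sum>i\<in>UNIV. ((if i \<in> S then 1/2 else 1) * (P *v x) $ i)\<^sup>2) + (norm (?M *v x))\<^sup>2 \<le> (norm (T *v x))\<^sup>2"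
    "det T \<noteq> 0" "2 ^ card S * \<bar>det T\<bar> \<le> 2 ^ CARD('m) * sqrt (det (?M ** transpose ?M))"
    by (rule adapted_transformation[OF rk, of S], rule that)
  define w where "w i = (if i \<in> S then 1/2 else 1 :: real)" for i
  have PT2: "(\<Sum>i\<in>UNIV. (w i * (P *v x) $ i)\<^sup>2) + (norm (?M *v x))\<^sup>2 \<le> (norm (T *v x))\<^sup>2" for x
    unfolding w_def by (rule PT(2))
  define v :: "'n + 'm \<Rightarrow> real^'n" where
    "v k = (case k of Inl i \<Rightarrow> w i *\<^sub>R P $ i | Inr j \<Rightarrow> ?M $ j)" for k
  have vl: "v (Inl i) \<bullet> x = w i * (P *v x) $ i" and vr: "v (Inr j) \<bullet> x = (?M *v x) $ j" for i j x
    by (simp_all add: v_def matrix_vector_mul_component)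
  \<comment> \<open>\<open>Z\<close> may be unbounded as far as is known here, so the comparison is
    made inside boxes, followed by monotone convergence.\<close>
  define X :: "nat \<Rightarrow> (real^'n) set" where "X N = cbox (\<chi> i. - real N) (\<chi> i. real N)" for N
  have X: "x \<in> X N \<longleftrightarrow> (\<forall>i. \<bar>x $ i\<bar> \<le> real N)" for x N
  proof -
    have "\<bar>t\<bar> \<le> r \<longleftrightarrow> - r \<le> t \<and> t \<le> r" for t r :: real by linarith
    thus ?thesis unfolding X_def mem_box_cart by simp
  qed
  define Z where "Z = {x. \<forall>k\<in>UNIV. \<bar>v k \<bullet> x\<bar> < 1/2}"
  have Zinj: "x = y" if x: "x \<in> Z" and y: "y \<in> Z" and int: "\<And>i. x $ i - y $ i \<in> \<int>" for x y
  proof -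
    have "\<forall>i. \<exists>k. x $ i - y $ i = real_of_int k" using int by (auto elim!: Ints_cases)
    then obtain z where z: "\<And>i. x $ i - y $ i = real_of_int (z i)" by metis
    define zi :: "int^'n" where "zi = (\<chi> i. z i)"
    let ?z = "\<chi> i. real_of_int (zi $ i)"
    have zxy: "?z = x - y" by (simp add: vec_eq_iff z zi_def)
    have less: "\<bar>v k \<bullet> ?z\<bar> < 1" for k
    proof -
      have "\<bar>v k \<bullet> x\<bar> < 1/2" "\<bar>v k \<bullet> y\<bar> < 1/2" using x y by (auto simp: Z_def)
      thus ?thesis unfolding zxy inner_diff_right by linarith
    qed
    have Mz: "(?M *v ?z) $ j = real_of_int ((B *v zi) $ j)" for j
      by (simp add: matrix_vector_mult_def map_matrix_def)
    have "(B *v zi) $ j = 0" for j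
      using less[of "Inr j"] unfolding vr Mz by linarith
    hence B0: "B *v zi = 0" by (simp add: vec_eq_iff)
    hence "?M *v ?z = 0" unfolding vec_eq_iff Mz by simp
    hence Pz: "P *v ?z = ?z" by (rule PT(1))
    have wz: "\<bar>w i * real_of_int (zi $ i)\<bar> < 1" for i
      using less[of "Inl i"] unfolding vl Pz by simp
    have "zi = 0"
    proof (rule small[OF B0])
      fix i
      show "\<bar>zi $ i\<bar> \<le> 1" using wz[of i] by (auto simp: w_def split: if_splits)
      show "zi $ i = 0" if "i \<notin> S" using wz[of i] that by (simp add: w_def)
    qed
    hence "?z = 0" by (simp add: vec_eq_iff)
    thus "x = y" using zxy by simp
  qed
  have [measurable]: "Z \<in> sets borel" unfolding Z_def by measurable
  have [measurable]: "X N \<in> sets borel" for N unfolding X_def by simp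
  let ?f = "\<lambda>x. exp (- (pi * (norm (T *v x))\<^sup>2))"
  have bound: "(\<integral>\<^sup>+x. ennreal (indicator (X N) x * ?f x) \<partial>lborel) \<le> 1" for N
  proof -
    have Q: "(\<Sum>k\<in>UNIV. (v k \<bullet> x)\<^sup>2) \<le> (norm (T *v x))\<^sup>2" for x
    proof -
      have "(\<Sum>k\<in>UNIV. (v k \<bullet> x)\<^sup>2) = (\<Sum>i\<in>UNIV. (v (Inl i) \<bullet> x)\<^sup>2) + (\<Sum>j\<in>UNIV. (v (Inr j) \<bullet> x)\<^sup>2)"
        by (simp add: UNIV_Plus_UNIV[symmetric] sum.Plus del: UNIV_Plus_UNIV)
      also have "(\<Sum>j\<in>UNIV. (v (Inr j) \<bullet> x)\<^sup>2) = (norm (?M *v x))\<^sup>2"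
        unfolding power2_norm_eq_inner vr by (simp add: inner_vec_def power2_eq_square)
      finally show ?thesis using PT2[of x] by (simp add: vl)
    qed
    have "(\<integral>\<^sup>+x. ennreal (indicator (X N) x * ?f x) \<partial>lborel)
       \<le> (\<integral>\<^sup>+x. ennreal (indicator (X N) x * exp (- (pi * (\<Sum>k\<in>UNIV. (v k \<bullet> x)\<^sup>2)))) \<partial>lborel)"
      by (intro nn_integral_mono ennreal_leI mult_left_mono) (simp_all add: Q)
    also have "\<dots> \<le> emeasure lborel (X N \<inter> Z)" unfolding Z_def
    proof (rule Vaaler_gaussian_le_volume)
      show "convex (X N)" unfolding X_def by (rule convex_box)
      show "\<bar>x \<bullet> b\<bar> \<le> real N" if "x \<in> X N" "b \<in> Basis" for x b
        using that X by (auto simp: Basis_vec_def inner_axis)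
    qed (auto simp: X)
    also have "\<dots> \<le> emeasure lborel Z" by (rule emeasure_mono) auto
    also have "\<dots> \<le> 1" by (rule emeasure_le_1_if_integer_translates_disjoint) (use Zinj in auto)
    finally show ?thesis .
  qed
  have "X m \<subseteq> X n" if "m \<le> n" for m n
  proof
    fix x assume "x \<in> X m"
    hence "\<bar>x $ i\<bar> \<le> real n" for i using that unfolding X by (meson of_nat_le_iff order_trans)
    thus "x \<in> X n" unfolding X by blast
  qed
  hence "(indicator (X m) x :: real) \<le> indicator (X n) x" if "m \<le> n" for m n x
    using that by (auto simp: indicator_def)
  hence inc: "incseq (\<lambda>N x. ennreal (indicator (X N) x * ?f x))"
    unfolding incseq_def le_fun_def by (intro allI impI ennreal_leI mult_right_mono) auto
  have sup: "(SUP N. ennreal (indicator (X N) x * ?f x)) = ennreal (?f x)" for x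
  proof (rule SUP_eqI)
    show "ennreal (indicator (X N) x * ?f x) \<le> ennreal (?f x)" for N
      by (rule ennreal_leI) (simp add: indicator_def)
    fix y assume y: "\<And>N. N \<in> UNIV \<Longrightarrow> ennreal (indicator (X N) x * ?f x) \<le> y"
    obtain N where "norm x \<le> real N" using real_arch_simple by blast
    hence "x \<in> X N" unfolding X using component_le_norm_cart order_trans by blast
    thus "ennreal (?f x) \<le> y" using y[of N] by simp
  qed
  have "(\<integral>\<^sup>+x. ennreal (?f x) \<partial>lborel) = (SUP N. \<integral>\<^sup>+x. ennreal (indicator (X N) x * ?f x) \<partial>lborel)"
    by (subst nn_integral_monotone_convergence_SUP[OF inc, symmetric]) (auto simp: sup)
  also have "\<dots> \<le> 1" by (rule SUP_least) (rule bound)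
  finally have le1: "(\<integral>\<^sup>+x. ennreal (?f x) \<partial>lborel) \<le> 1" .
  have "1 = (\<integral>\<^sup>+x. ennreal (exp (- (pi * (norm x)\<^sup>2))) \<partial>(lborel :: (real^'n) measure))"
    by (rule nn_integral_gaussian_euclidean[symmetric])
  also have "\<dots> = ennreal \<bar>det T\<bar> * (\<integral>\<^sup>+x. ennreal (?f x) \<partial>lborel)"
    by (rule nn_integral_linear[OF PT(3)]) measurable
  also have "\<dots> \<le> ennreal \<bar>det T\<bar> * 1" using le1 by (intro mult_left_mono) auto
  finally have "1 \<le> \<bar>det T\<bar>" by simp
  hence "2 ^ card S * 1 \<le> 2 ^ card S * \<bar>det T\<bar>" by (intro mult_left_mono) auto
  also note PT(4)
  finally show ?thesis by simp
qed

section \<open>The lattice generated by the columns\<close>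

lemma det_row_sums:
  fixes a :: "'m::finite \<Rightarrow> 'n::finite \<Rightarrow> 'a::comm_ring_1^'m"
  shows "det (\<chi> k. \<Sum>j\<in>UNIV. a k j) = (\<Sum>f\<in>UNIV. det (\<chi> k. a k (f k)))"
proof -
  have "(\<Prod>k\<in>UNIV. (\<Sum>j\<in>UNIV. a k j $ p k)) = (\<Sum>f\<in>UNIV. \<Prod>k\<in>UNIV. a k (f k) $ p k)" for p :: "'m \<Rightarrow> 'm"
    by (subst prod_sum_PiE) (auto simp: PiE_UNIV_domain)
  hence "det (\<chi> k. \<Sum>j\<in>UNIV. a k j)
     = (\<Sum>p\<in>{p. p permutes UNIV}. \<Sum>f\<in>UNIV. of_int (sign p) * (\<Prod>k\<in>UNIV. a k (f k) $ p k))"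
    by (simp add: det_def sum_distrib_left)
  also have "\<dots> = (\<Sum>f\<in>UNIV. det (\<chi> k. a k (f k)))"
    by (subst sum.swap) (simp add: det_def)
  finally show ?thesis .
qed

text \<open>A Cauchy-Binet expansion without collecting terms: multilinearity gives one summand per
  choice of columns \<open>f\<close>, which is a multiple of a minor if \<open>f\<close> is
  injective and 0 otherwise.\<close>

lemma gcd_maximal_minors_dvd_det:
  fixes A :: "int^'n^'m" and W :: "int^'m^'n"
  shows "gcd_maximal_minors A dvd det (A ** W)"
proof -
  let ?a = "\<lambda>k j. W $ j $ k *s column j A"
  have "transpose (A ** W) = (\<chi> k. \<Sum>j\<in>UNIV. ?a k j)"
    by (simp add: vec_eq_iff transpose_def matrix_matrix_mult_def column_def mult.commute)
  hence "det (A ** W) = det (\<chi> k. \<Sum>j\<in>UNIV. ?a k j)" using det_transpose[of "A ** W"] by (simp only:)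
  also have "\<dots> = (\<Sum>f\<in>UNIV. det (\<chi> k. ?a k (f k)))"
    by (simp add: det_row_sums)
  finally have sum: "det (A ** W) = (\<Sum>f\<in>UNIV. det (\<chi> k. ?a k (f k)))" .
  show ?thesis unfolding sum
  proof (rule dvd_sum)
    fix f :: "'m \<Rightarrow> 'n"
    let ?D = "det ((\<chi> k. column (f k) A) :: int^'m^'m)"
    have "gcd_maximal_minors A dvd ?D"
    proof (cases "inj f")
      case True
      have "?D = det (transpose (\<chi> k. column (f k) A) :: int^'m^'m)" by (simp only: det_transpose)
      also have "transpose (\<chi> k. column (f k) A) = (\<chi> i k. A $ i $ f k)"
        by (simp add: vec_eq_iff transpose_def column_def)
      finally have "?D \<in> maximal_minors A" using True by (auto simp: maximal_minors_def)
      thus ?thesis unfolding gcd_maximal_minors_def by (rule Gcd_dvd)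
    next
      case False
      then obtain i j where "i \<noteq> j" "f i = f j" by (auto simp: inj_def)
      hence "?D = 0" by (intro det_identical_rows[of i j]) (auto simp: row_def vec_eq_iff)
      thus ?thesis by simp
    qed
    moreover have "det (\<chi> k. ?a k (f k)) = (\<Prod>k\<in>UNIV. W $ f k $ k) * ?D" by (rule det_rows_mul)
    ultimately show "gcd_maximal_minors A dvd det (\<chi> k. ?a k (f k))" by simp
  qed
qed

section \<open>Passage between integer and real matrices, and linearity in a column\<close>

lemma real_matrix_component: "real_matrix X $ i $ j = real_of_int (X $ i $ j)"
  by (simp add: map_matrix_def)

lemma real_of_int_det: "real_of_int (det X) = det (real_matrix X)"
  by (simp add: det_def map_matrix_def)

lemma real_matrix_mult: "real_matrix (X ** Y) = real_matrix X ** real_matrix Y"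
  by (simp add: vec_eq_iff map_matrix_def matrix_matrix_mult_def)

lemma real_matrix_transpose: "real_matrix (transpose X) = transpose (real_matrix X)"
  by (simp add: vec_eq_iff map_matrix_def transpose_def)

text \<open>This is the division step: subtracting \<open>q\<close> times the old column turns a
  Cramer determinant into its remainder modulo \<open>det X\<close>.\<close>

lemma det_replace_column_diff:
  fixes X :: "'a::comm_ring_1^'m^'m"
  shows "det (\<chi> i j. if j = k then v $ i - q * X $ i $ k else X $ i $ j)
    = det (\<chi> i j. if j = k then v $ i else X $ i $ j) - q * det X"
proof -
  let ?r = "\<lambda>w. \<chi> i j. if j = k then w $ i else X $ i $ j"
  have tr: "det (?r w) = det (\<chi> j. if j = k then w else column j X)" for w
  proof -
    have "transpose (?r w) = (\<chi> j. if j = k then w else column j X)"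
      by (auto simp: vec_eq_iff transpose_def column_def)
    thus ?thesis using det_transpose[of "?r w"] by (simp only:)
  qed
  have "det (\<chi> i j. if j = k then v $ i - q * X $ i $ k else X $ i $ j) = det (?r (v + (- q) *s column k X))"
    by (rule arg_cong[where f = det]) (auto simp: vec_eq_iff column_def)
  also have "\<dots> = det (?r v) + det (?r ((- q) *s column k X))"
    unfolding tr by (rule det_row_add)
  also have "det (?r ((- q) *s column k X)) = - q * det (?r (column k X))"
    unfolding tr by (rule det_row_mul)
  also have "?r (column k X) = X" by (auto simp: vec_eq_iff column_def)
  finally show ?thesis by simp
qed

text \<open>The columns of \<open>H\<close> form a basis of the lattice \<open>A \<int>\<^sup>n\<close>: among all nonsingular \<open>A ** W\<close> pick one of
  minimal determinant; Cramer's rule and division with remainder then give integral coordinates.\<close>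

lemma lattice_basis_factorization:
  fixes A :: "int^'n^'m"
  assumes rk: "rank (real_matrix A) = CARD('m)"
  obtains H :: "int^'m^'m" and B :: "int^'n^'m"
  where "A = H ** B" "det H \<noteq> 0" "gcd_maximal_minors A dvd det H"
proof -
  let ?good = "\<lambda>W :: int^'m^'n. det (A ** W) \<noteq> 0"
  have "?good (transpose A)"
  proof
    assume "det (A ** transpose A) = 0"
    hence "det (real_matrix A ** transpose (real_matrix A)) = 0"
      by (metis of_int_0 real_matrix_mult real_matrix_transpose real_of_int_det)
    thus False using det_gram_nonzero[OF rk] by simp
  qed
  then obtain W where W: "?good W" and
    min: "\<And>W'. ?good W' \<Longrightarrow> nat \<bar>det (A ** W)\<bar> \<le> nat \<bar>det (A ** W')\<bar>"
    using ex_has_least_nat[of ?good _ "\<lambda>W. nat \<bar>det (A ** W)\<bar>"] by metis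
  define H where "H = A ** W"
  define h where "h = det H"
  have h: "h \<noteq> 0" using W by (simp add: h_def H_def)
  \<comment> \<open>The Cramer numerator of the \<open>k\<close>-th coordinate of
    \<open>A *v x\<close> with respect to the columns of \<open>H\<close>.\<close>
  define c where "c k x = det (\<chi> i j. if j = k then (A *v x) $ i else H $ i $ j)" for k x
  have dvd: "h dvd c k x" for k x
  proof -
    define q where "q = c k x div h"
    \<comment> \<open>A nonzero remainder would be the determinant of \<open>A ** W'\<close> and
      smaller in absolute value than \<open>h\<close>, against minimality.\<close>
    define W' :: "int^'m^'n" where "W' = (\<chi> i j. if j = k then x $ i - q * W $ i $ k else W $ i $ j)"
    have "A ** W' = (\<chi> i j. if j = k then (A *v x) $ i - q * H $ i $ k else H $ i $ j)"
      by (auto simp: vec_eq_iff W'_def H_def matrix_matrix_mult_def matrix_vector_mult_def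
          right_diff_distrib sum_subtractf sum_distrib_left mult_ac)
    hence "det (A ** W') = c k x - q * h"
      by (simp add: det_replace_column_diff c_def h_def)
    hence d: "det (A ** W') = c k x mod h" by (simp add: q_def minus_div_mult_eq_mod)
    have "\<not> ?good W'"
    proof
      assume g: "?good W'"
      have "\<bar>c k x mod h\<bar> < \<bar>h\<bar>" using h by (simp add: abs_mod_less)
      thus False using min[OF g] d by (simp add: h_def H_def nat_le_eq_zle)
    qed
    thus ?thesis using d by (simp add: mod_eq_0_iff_dvd)
  qed
  define B :: "int^'n^'m" where "B = (\<chi> k j. c k (axis j 1) div h)"
  have "A = H ** B"
  proof -
    have "real_matrix A *v axis j 1 = real_matrix (H ** B) *v axis j 1" for j
    proof -
      let ?a = "real_matrix A *v axis j 1"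
      have inv: "invertible (real_matrix H)"
        using h by (simp add: invertible_det_nz h_def flip: real_of_int_det)
      then obtain x where x: "real_matrix H *v x = ?a"
        by (metis invertible_right_inverse matrix_vector_mul_assoc matrix_vector_mul_lid)
      have "(A *v axis j 1) $ i = (\<Sum>l\<in>UNIV. if l = j then A $ i $ l else 0)" for i
        unfolding matrix_vector_mult_def axis_def vec_lambda_beta by (rule sum.cong) auto
      hence a: "?a $ i = real_of_int ((A *v axis j 1) $ i)" for i
        by (simp add: matrix_vector_mult_basis column_def map_matrix_def)
      have "x $ k = real_of_int (B $ k $ j)" for k
      proof -
        have "x $ k * det (real_matrix H)
            = det (\<chi> i l. if l = k then (real_matrix H *v x) $ i else real_matrix H $ i $ l)"
          by (rule cramer_lemma[symmetric])
        also have "\<dots> = det (real_matrix (\<chi> i l. if l = k then (A *v axis j 1) $ i else H $ i $ l))"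
          unfolding x by (rule arg_cong[where f = det]) (auto simp: vec_eq_iff a real_matrix_component)
        also have "\<dots> = real_of_int (c k (axis j 1))" by (simp only: c_def real_of_int_det)
        also have "c k (axis j 1) = B $ k $ j * h" using dvd[of k "axis j 1"] by (simp add: B_def)
        also have "real_of_int (B $ k $ j * h) = real_of_int (B $ k $ j) * det (real_matrix H)"
          by (simp add: h_def real_of_int_det)
        finally show ?thesis using h by (simp add: h_def flip: real_of_int_det)
      qed
      hence "x = real_matrix B *v axis j 1"
        by (simp add: vec_eq_iff matrix_vector_mult_basis column_def map_matrix_def)
      thus ?thesis using x by (simp add: real_matrix_mult flip: matrix_vector_mul_assoc)
    qed
    hence "real_matrix A $ i $ j = real_matrix (H ** B) $ i $ j" for i j
      by (metis (no_types) column_def matrix_vector_mult_basis vec_lambda_beta)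
    thus ?thesis by (simp add: vec_eq_iff map_matrix_def)
  qed
  moreover have "gcd_maximal_minors A dvd det H" unfolding H_def by (rule gcd_maximal_minors_dvd_det)
  ultimately show ?thesis using that h h_def by blast
qed

text \<open>Writing \<open>A = H ** B\<close> multiplies the Gram determinant of \<open>B\<close> by
  \<open>(det H)^2\<close>, and the gcd is at most \<open>\<bar>det H\<bar>\<close> because it
  divides this nonzero integer. Kernel vectors of \<open>B\<close> are kernel vectors of
  \<open>A\<close>.\<close>

lemma card_support_le_gram:
  fixes A :: "int^'n^'m"
  assumes rk: "rank (real_matrix A) = CARD('m)"
    and small: "\<And>y :: int^'n. A *v y = 0 \<Longrightarrow> (\<And>i. \<bar>y $ i\<bar> \<le> 1) \<Longrightarrow> (\<And>i. i \<notin> S \<Longrightarrow> y $ i = 0) \<Longrightarrow> y = 0"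
  shows "0 < gcd_maximal_minors A"
    and "2 ^ card S * real_of_int (gcd_maximal_minors A)
      \<le> 2 ^ CARD('m) * sqrt (real_of_int (det (A ** transpose A)))"
proof -
  obtain H :: "int^'m^'m" and B :: "int^'n^'m"
    where A: "A = H ** B" and H: "det H \<noteq> 0" and g: "gcd_maximal_minors A dvd det H"
    using lattice_basis_factorization[OF rk] by blast
  show pos: "0 < gcd_maximal_minors A"
  proof -
    have "gcd_maximal_minors A \<noteq> 0" using g H by auto
    moreover have "0 \<le> gcd_maximal_minors A" by (simp add: gcd_maximal_minors_def)
    ultimately show ?thesis by simp
  qed
  have "gcd_maximal_minors A \<le> \<bar>det H\<bar>" using dvd_imp_le_int[OF H g] by simp
  hence gH: "real_of_int (gcd_maximal_minors A) \<le> \<bar>real_of_int (det H)\<bar>" by linarith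
  have "CARD('m) \<le> rank (real_matrix B)"
    unfolding rk[symmetric] A real_matrix_mult by (rule rank_mul_le_right)
  moreover have "rank (real_matrix B) \<le> CARD('m)" using rank_bound[of "real_matrix B"] by simp
  ultimately have rkB: "rank (real_matrix B) = CARD('m)" by simp
  have gram: "2 ^ card S \<le> 2 ^ CARD('m) * sqrt (det (real_matrix B ** transpose (real_matrix B)))"
  proof (rule card_support_le_gram_primitive[OF rkB])
    fix y :: "int^'n" assume "B *v y = 0" "\<And>i. \<bar>y $ i\<bar> \<le> 1" "\<And>i. i \<notin> S \<Longrightarrow> y $ i = 0"
    thus "y = 0" by (intro small) (auto simp: A simp flip: matrix_vector_mul_assoc)
  qed
  hence "2 ^ card S * real_of_int (gcd_maximal_minors A)
    \<le> 2 ^ CARD('m) * sqrt (det (real_matrix B ** transpose (real_matrix B))) * \<bar>real_of_int (det H)\<bar>"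
    using gH pos order_trans[OF zero_le_power gram] by (intro mult_mono gram) auto
  also have "\<dots> = 2 ^ CARD('m) * sqrt (real_of_int (det (A ** transpose A)))"
  proof -
    have "A ** transpose A = H ** ((B ** transpose B) ** transpose H)"
      unfolding A by (simp add: matrix_transpose_mul matrix_mul_assoc)
    hence "det (A ** transpose A) = (det H)\<^sup>2 * det (B ** transpose B)"
      by (simp add: det_mul det_transpose power2_eq_square)
    thus ?thesis by (simp add: real_sqrt_mult real_of_int_det real_matrix_mult real_matrix_transpose)
  qed
  finally show "2 ^ card S * real_of_int (gcd_maximal_minors A)
      \<le> 2 ^ CARD('m) * sqrt (real_of_int (det (A ** transpose A)))" .
qed

section \<open>The bound in terms of the entries\<close>

text \<open>Gram-Schmidt without normalisation: row operations of determinant 1 preserve the Gram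
  determinant, and removing an orthogonal projection cannot lengthen a row.\<close>

lemma orthogonalize_rows:
  fixes B :: "real^'n^'m"
  shows "\<exists>B' :: real^'n^'m. det (B' ** transpose B') = det (B ** transpose B)
    \<and> (\<forall>i. i \<notin> I \<longrightarrow> B' $ i = B $ i) \<and> (\<forall>i. norm (B' $ i) \<le> norm (B $ i))
    \<and> (\<forall>i\<in>I. \<forall>j\<in>I. i \<noteq> j \<longrightarrow> B' $ i \<bullet> B' $ j = 0)"
proof (induction I rule: finite_induct[OF finite])
  case 1
  show ?case by (intro exI[of _ B]) auto
next
  case (2 k I)
  then obtain B' :: "real^'n^'m" where B': "det (B' ** transpose B') = det (B ** transpose B)"
    "\<And>i. i \<notin> I \<Longrightarrow> B' $ i = B $ i" "\<And>i. norm (B' $ i) \<le> norm (B $ i)"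
    "\<And>i j. i \<in> I \<Longrightarrow> j \<in> I \<Longrightarrow> i \<noteq> j \<Longrightarrow> B' $ i \<bullet> B' $ j = 0" by blast
  \<comment> \<open>If row \<open>j\<close> is zero, the quotient is 0 by convention and the
    orthogonality below still holds.\<close>
  define c where "c j = (B' $ k \<bullet> B' $ j) / (B' $ j \<bullet> B' $ j)" for j
  define p where "p = (\<Sum>j\<in>I. c j *\<^sub>R B' $ j)"
  define E :: "real^'m^'m" where
    "E = (\<chi> i. if i = k then row k (mat 1) + (\<Sum>j\<in>I. (- c j) *s row j (mat 1)) else row i (mat 1))"
  have "(\<Sum>j\<in>I. (- c j) *s row j (mat 1)) \<in> vec.span {row j (mat 1 :: real^'m^'m) | j. j \<noteq> k}"
    by (intro vec.span_sum vec.span_scale vec.span_base) (use 2 in auto)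
  hence detE: "det E = 1" unfolding E_def by (subst det_row_span) auto
  define B'' where "B'' = E ** B'"
  have rowk: "B'' $ k = B' $ k - p"
  proof (subst vec_eq_iff, rule allI)
    fix l
    have "B'' $ k $ l = (\<Sum>i\<in>UNIV. (if i = k then B' $ i $ l else 0) - (if i \<in> I then c i * B' $ i $ l else 0))"
      unfolding B''_def matrix_matrix_mult_def E_def row_def mat_def
      using 2 by (auto intro!: sum.cong simp: sum_negf if_distrib cong: if_cong)
    also have "\<dots> = B' $ k $ l - (\<Sum>i\<in>I. c i * B' $ i $ l)"
      by (simp add: sum_subtractf flip: sum.inter_restrict)
    finally show "B'' $ k $ l = (B' $ k - p) $ l" by (simp add: p_def)
  qed
  have rowi: "B'' $ i = B' $ i" if "i \<noteq> k" for i
  proof (subst vec_eq_iff, rule allI)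
    fix l
    have "B'' $ i $ l = (\<Sum>j\<in>UNIV. if j = i then B' $ j $ l else 0)"
      unfolding B''_def matrix_matrix_mult_def E_def row_def mat_def vec_lambda_beta
      using that by (intro sum.cong) auto
    thus "B'' $ i $ l = B' $ i $ l" by simp
  qed
  have orth: "(B' $ k - p) \<bullet> B' $ l = 0" if "l \<in> I" for l
  proof -
    have "p \<bullet> B' $ l = (\<Sum>j\<in>I. if j = l then c l * (B' $ l \<bullet> B' $ l) else 0)"
      unfolding p_def inner_sum_left using B'(4) that by (intro sum.cong) auto
    also have "\<dots> = c l * (B' $ l \<bullet> B' $ l)" using that 2 by simp
    also have "\<dots> = B' $ k \<bullet> B' $ l" by (simp add: c_def)
    finally show ?thesis by (simp add: inner_diff_left)
  qed
  hence orthp: "(B' $ k - p) \<bullet> p = 0" by (simp add: p_def inner_sum_right)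
  have "(norm (B' $ k))\<^sup>2 = (norm (B' $ k - p))\<^sup>2 + (norm p)\<^sup>2"
    using norm_add_Pythagorean[of "B' $ k - p" p, unfolded orthogonal_def, OF orthp] by simp
  hence "(norm (B' $ k - p))\<^sup>2 \<le> (norm (B' $ k))\<^sup>2" using zero_le_power2[of "norm p"] by linarith
  hence "norm (B' $ k - p) \<le> norm (B' $ k)" by (rule power2_le_imp_le) simp
  hence n: "norm (B'' $ i) \<le> norm (B $ i)" for i
    using rowk rowi[of i] B'(3)[of i] by (cases "i = k") auto
  have "B'' ** transpose B'' = E ** ((B' ** transpose B') ** transpose E)"
    unfolding B''_def by (simp add: matrix_transpose_mul matrix_mul_assoc)
  hence "det (B'' ** transpose B'') = det (B ** transpose B)"
    by (simp add: det_mul det_transpose detE B'(1))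
  moreover have "B'' $ i \<bullet> B'' $ j = 0" if ij: "i \<in> insert k I" "j \<in> insert k I" "i \<noteq> j" for i j
  proof -
    consider "i = k" "j \<in> I" "j \<noteq> k" | "j = k" "i \<in> I" "i \<noteq> k" | "i \<in> I" "j \<in> I" "i \<noteq> k" "j \<noteq> k"
      using ij by auto
    thus ?thesis
    proof cases
      case 2 thus ?thesis using orth by (metis inner_commute rowi rowk)
    qed (use orth rowk rowi B'(4) ij in auto)
  qed
  ultimately show ?case using n rowi B'(2) by (intro exI[of _ B'']) auto
qed

lemma Hadamard_gram:
  fixes B :: "real^'n^'m"
  shows "det (B ** transpose B) \<le> (\<Prod>k\<in>UNIV. (norm (B $ k))\<^sup>2)"
proof -
  obtain B' :: "real^'n^'m" where B': "det (B' ** transpose B') = det (B ** transpose B)"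
    "\<And>i. norm (B' $ i) \<le> norm (B $ i)" "\<And>i j. i \<noteq> j \<Longrightarrow> B' $ i \<bullet> B' $ j = 0"
    using orthogonalize_rows[of B UNIV] by auto
  have ent: "(B' ** transpose B') $ i $ j = B' $ i \<bullet> B' $ j" for i j
    by (simp add: matrix_matrix_mult_def transpose_def inner_vec_def)
  have "det (B' ** transpose B') = (\<Prod>k\<in>UNIV. (norm (B' $ k))\<^sup>2)"
    by (subst det_diagonal) (simp_all only: ent B'(3) power2_norm_eq_inner not_False_eq_True)
  also have "\<dots> \<le> (\<Prod>k\<in>UNIV. (norm (B $ k))\<^sup>2)"
    by (intro prod_mono conjI power_mono B'(2)) auto
  finally show ?thesis using B'(1) by simp
qed

text \<open>The selected rows contain a basis \<open>I0\<close> of the span of the rows of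
  \<open>A\<close> restricted to \<open>S\<close>. A vector supported on \<open>S\<close> and killed
  by \<open>B\<close> is thus orthogonal to all restricted rows, hence killed by
  \<open>A\<close>.\<close>

lemma full_rank_completion:
  fixes A :: "int^'n^'m"
  assumes rk: "rank (real_matrix A) = CARD('m)"
  obtains B :: "int^'n^'m" where "rank (real_matrix B) = CARD('m)"
    "\<And>k. (\<exists>i. B $ k = (\<chi> j. if j \<in> S then A $ i $ j else 0)) \<or> (\<exists>j. j \<notin> S \<and> B $ k = axis j 1)"
    "\<And>y. (\<And>i. i \<notin> S \<Longrightarrow> y $ i = 0) \<Longrightarrow> B *v y = 0 \<Longrightarrow> A *v y = 0"
proof -
  define r :: "int^'n \<Rightarrow> real^'n" where "r z = (\<chi> j. real_of_int (z $ j))" for z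
  define R :: "'m \<Rightarrow> int^'n" where "R i = (\<chi> j. if j \<in> S then A $ i $ j else 0)" for i
  define V0 where "V0 = range (\<lambda>i. r (R i))"
  define V where "V = V0 \<union> r ` {axis j 1 | j. j \<notin> S}"
  obtain I0 where I0: "I0 \<subseteq> V0" "independent I0" "V0 \<subseteq> span I0" "card I0 = dim V0"
    by (rule basis_exists)
  have "I0 \<subseteq> V" using I0(1) by (auto simp: V_def)
  then obtain I1 where I1: "I0 \<subseteq> I1" "I1 \<subseteq> V" "independent I1" "V \<subseteq> span I1"
    using I0(2) by (rule maximal_independent_subset_extend)
  have fin: "finite I1" using I1(3) by (rule finiteI_independent)
  have "rows (real_matrix A) \<subseteq> span V"
  proof
    fix x assume "x \<in> rows (real_matrix A)"
    then obtain i where x: "x = row i (real_matrix A)" by (auto simp: rows_def)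
    \<comment> \<open>Each row of \<open>A\<close> is its restriction plus unit vectors outside
      \<open>S\<close>, so \<open>V\<close> spans at least as many dimensions as \<open>A\<close>
      has rows.\<close>
    have "x = r (R i) + (\<Sum>j\<in>-S. real_of_int (A $ i $ j) *\<^sub>R r (axis j 1))"
      by (simp add: vec_eq_iff x r_def R_def row_def real_matrix_component axis_def if_distrib cong: if_cong)
    also have "\<dots> \<in> span V"
      by (intro span_add span_sum span_scale span_base) (auto simp: V_def V0_def)
    finally show "x \<in> span V" .
  qed
  hence "CARD('m) \<le> dim V" using rk by (metis dim_subset dim_span row_rank_def)
  also have "dim V = card I1" using I1 by (metis basis_card_eq_dim)
  finally have "CARD('m) \<le> card I1" .
  moreover have "card I0 \<le> CARD('m)"
    using card_mono[OF _ I0(1)] card_image_le[of "UNIV :: 'm set" "\<lambda>i. r (R i)"] by (simp add: V0_def)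
  ultimately obtain J where J: "I0 \<subseteq> J" "J \<subseteq> I1" "card J = CARD('m)"
    using exists_subset_between[of I0 "CARD('m)" I1] I1(1) fin by auto
  have finJ: "finite J" using J(2) fin by (rule finite_subset)
  obtain \<rho> where \<rho>: "bij_betw \<rho> (UNIV :: 'm set) J"
    using finite_same_card_bij[of "UNIV :: 'm set" J] finJ J(3) by auto
  have "\<exists>z. ((\<exists>i. z = R i) \<or> (\<exists>j. j \<notin> S \<and> z = axis j 1)) \<and> r z = \<rho> k" for k
  proof -
    have "\<rho> k \<in> V" using \<rho> J(2) I1(2) by (auto simp: bij_betw_def)
    thus ?thesis unfolding V_def V0_def by fastforce
  qed
  then obtain \<beta> where \<beta>: "\<And>k. (\<exists>i. \<beta> k = R i) \<or> (\<exists>j. j \<notin> S \<and> \<beta> k = axis j 1)" "\<And>k. r (\<beta> k) = \<rho> k"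
    by metis
  define B :: "int^'n^'m" where "B = (\<chi> k. \<beta> k)"
  have rowB: "real_matrix B $ k = \<rho> k" for k
    using \<beta>(2)[of k] by (simp add: vec_eq_iff r_def B_def real_matrix_component)
  show ?thesis
  proof (rule that)
    have "rows (real_matrix B) = J"
      using \<rho> rowB by (auto simp: rows_def row_def vec_lambda_eta bij_betw_def)
    moreover have "independent J" using I1(3) J(2) by (rule independent_mono)
    ultimately show "rank (real_matrix B) = CARD('m)"
      using J(3) by (simp add: row_rank_def dim_eq_card_independent)
    show "(\<exists>i. B $ k = (\<chi> j. if j \<in> S then A $ i $ j else 0)) \<or> (\<exists>j. j \<notin> S \<and> B $ k = axis j 1)" for k
      using \<beta>(1)[of k] by (simp add: B_def R_def)
  next
    fix y :: "int^'n" assume y: "\<And>i. i \<notin> S \<Longrightarrow> y $ i = 0" and By: "B *v y = 0"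
    have dot: "r z \<bullet> r y = real_of_int (\<Sum>j\<in>UNIV. z $ j * y $ j)" for z
      by (simp add: r_def inner_vec_def)
    have "x \<bullet> r y = 0" if x: "x \<in> I0" for x
    proof -
      obtain k where k: "x = r (\<beta> k)" using x J(1) \<rho> \<beta>(2) by (metis bij_betw_imp_surj_on imageE subsetD)
      have "(\<Sum>j\<in>UNIV. \<beta> k $ j * y $ j) = (B *v y) $ k" by (simp add: B_def matrix_vector_mult_def)
      thus ?thesis unfolding k dot using By by simp
    qed
    hence "orthogonal (r y) x" if "x \<in> I0" for x using that by (simp add: orthogonal_def inner_commute)
    hence "orthogonal (r y) x" if "x \<in> span I0" for x using that orthogonal_to_span by blast
    moreover have "r (R i) \<in> span I0" for i using I0(3) by (auto simp: V0_def)
    ultimately have "r (R i) \<bullet> r y = 0" for i by (metis inner_commute orthogonal_def)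
    hence "(\<Sum>j\<in>UNIV. R i $ j * y $ j) = 0" for i by (simp only: dot of_int_eq_0_iff)
    moreover have "(A *v y) $ i = (\<Sum>j\<in>UNIV. R i $ j * y $ j)" for i
      unfolding matrix_vector_mult_def vec_lambda_beta R_def using y by (intro sum.cong) auto
    ultimately show "A *v y = 0" by (simp add: vec_eq_iff)
  qed
qed

section \<open>Entry sizes and the resulting support bound\<close>

lemma abs_entry_le_max_abs_entry: "\<bar>A $ i $ j\<bar> \<le> max_abs_entry A"
proof -
  have "{\<bar>A $ i $ j\<bar> | i j. True} = (\<lambda>(i, j). \<bar>A $ i $ j\<bar>) ` UNIV" by auto
  hence "finite {\<bar>A $ i $ j\<bar> | i j. True}" by simp
  thus ?thesis unfolding max_abs_entry_def by (intro Max_ge) auto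
qed

lemma max_abs_entry_pos:
  fixes A :: "int^'n^'m"
  assumes rk: "rank (real_matrix A) = CARD('m)"
  shows "1 \<le> max_abs_entry A"
proof (rule ccontr)
  assume "\<not> 1 \<le> max_abs_entry A"
  hence "A $ i $ j = 0" for i j using abs_entry_le_max_abs_entry[of A i j] by linarith
  hence "real_matrix A = 0" by (simp add: vec_eq_iff real_matrix_component)
  thus False using rk by simp
qed

text \<open>The tangent to \<open>ln\<close> at 2 lies above the curve; its comparison with
  \<open>t * ln 2\<close> uses only \<open>1/2 \<le> ln 2 \<le> 1\<close>.\<close>

lemma log2_le_self:
  assumes "0 < (t::real)"
  shows "log 2 t \<le> t"
proof -
  have l2: "1/2 \<le> ln (2::real)" "ln (2::real) \<le> 1" using ln2_ge_two_thirds ln_le_minus_one[of 2] by auto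
  have "ln (t / 2) \<le> t / 2 - 1" using assms by (intro ln_le_minus_one) auto
  hence "ln t \<le> ln 2 - 1 + t / 2" using assms by (simp add: ln_div)
  also have "\<dots> \<le> t * ln 2"
  proof -
    have "t * (1/2) \<le> t * ln 2" using l2 assms by (intro mult_left_mono) auto
    thus ?thesis using l2 by linarith
  qed
  finally show ?thesis by (simp add: log_def field_simps)
qed

lemma card_support_le_entries:
  fixes A :: "int^'n^'m"
  assumes rk: "rank (real_matrix A) = CARD('m)"
    and small: "\<And>y :: int^'n. A *v y = 0 \<Longrightarrow> (\<And>i. \<bar>y $ i\<bar> \<le> 1) \<Longrightarrow> (\<And>i. i \<notin> S \<Longrightarrow> y $ i = 0) \<Longrightarrow> y = 0"
  shows "real (card S) \<le> 2 * real CARD('m) *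
      log 2 (2 * sqrt (real CARD('m)) * real_of_int (max_abs_entry A))"
proof -
  define a m s where "a = real_of_int (max_abs_entry A)" and "m = CARD('m)" and "s = card S"
  have a: "1 \<le> a" using max_abs_entry_pos[OF rk] by (simp add: a_def)
  have m: "1 \<le> m" by (simp add: m_def Suc_le_eq)
  show ?thesis
  proof (cases "s = 0")
    case True
    have "1 * 1 * 1 \<le> 2 * sqrt (real m) * a" using a m by (intro mult_mono) auto
    hence "0 \<le> log 2 (2 * sqrt (real m) * a)" by (intro zero_le_log_cancel_iff[THEN iffD2]) linarith+
    hence "0 \<le> real m * log 2 (2 * sqrt (real m) * a)" by simp
    thus ?thesis using True by (simp add: s_def a_def m_def)
  next
    case False
    hence s: "1 \<le> s" by simp
    obtain B :: "int^'n^'m" where B: "rank (real_matrix B) = CARD('m)"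
      "\<And>k. (\<exists>i. B $ k = (\<chi> j. if j \<in> S then A $ i $ j else 0)) \<or> (\<exists>j. j \<notin> S \<and> B $ k = axis j 1)"
      "\<And>y. (\<And>i. i \<notin> S \<Longrightarrow> y $ i = 0) \<Longrightarrow> B *v y = 0 \<Longrightarrow> A *v y = 0"
      using full_rank_completion[OF rk, of S] by blast
    \<comment> \<open>A restricted row has at most \<open>s\<close> nonzero entries. A unit row fits
      the same bound because \<open>s\<close> and \<open>a\<close> are at least 1.\<close>
    have nrm: "(norm (real_matrix B $ k))\<^sup>2 \<le> real s * a\<^sup>2" for k
    proof -
      have n: "(norm (real_matrix B $ k))\<^sup>2 = (\<Sum>j\<in>UNIV. (real_of_int (B $ k $ j))\<^sup>2)"
        unfolding power2_norm_eq_inner by (simp add: inner_vec_def real_matrix_component power2_eq_square)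
      from B(2)[of k] show ?thesis
      proof
        assume "\<exists>i. B $ k = (\<chi> j. if j \<in> S then A $ i $ j else 0)"
        then obtain i where i: "B $ k = (\<chi> j. if j \<in> S then A $ i $ j else 0)" by blast
        have "(\<Sum>j\<in>UNIV. (real_of_int (B $ k $ j))\<^sup>2) = (\<Sum>j\<in>S. (real_of_int (A $ i $ j))\<^sup>2)"
          by (rule sum.mono_neutral_cong_right) (auto simp: i)
        also have "\<dots> \<le> (\<Sum>j\<in>S. a\<^sup>2)"
        proof (rule sum_mono)
          fix j
          have "\<bar>real_of_int (A $ i $ j)\<bar> \<le> a"
            using abs_entry_le_max_abs_entry[of A i j] by (simp add: a_def flip: of_int_abs)
          thus "(real_of_int (A $ i $ j))\<^sup>2 \<le> a\<^sup>2"
            using power_mono[of "\<bar>real_of_int (A $ i $ j)\<bar>" a 2] by simp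
        qed
        finally show ?thesis unfolding n by (simp add: s_def)
      next
        assume "\<exists>j. j \<notin> S \<and> B $ k = axis j 1"
        then obtain j where j: "B $ k = axis j 1" by blast
        have "(\<Sum>l\<in>UNIV. (real_of_int (B $ k $ l))\<^sup>2) = (\<Sum>l\<in>UNIV. if l = j then 1 else 0)"
          by (rule sum.cong) (auto simp: j axis_def)
        also have "\<dots> = 1 * 1" by simp
        also have "\<dots> \<le> real s * a\<^sup>2" using s a by (intro mult_mono) (auto simp: one_le_power)
        finally show ?thesis unfolding n .
      qed
    qed
    have "det (real_matrix B ** transpose (real_matrix B)) \<le> (\<Prod>k\<in>(UNIV :: 'm set). (norm (real_matrix B $ k))\<^sup>2)"
      by (rule Hadamard_gram)
    also have "\<dots> \<le> (\<Prod>k\<in>(UNIV :: 'm set). real s * a\<^sup>2)" by (intro prod_mono) (simp add: nrm)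
    finally have det: "real_of_int (det (B ** transpose B)) \<le> (real s * a\<^sup>2) ^ m"
      by (simp add: real_of_int_det real_matrix_mult real_matrix_transpose m_def)
    have smallB: "y = 0" if "B *v y = 0" "\<And>i. \<bar>y $ i\<bar> \<le> 1" "\<And>i. i \<notin> S \<Longrightarrow> y $ i = 0" for y :: "int^'n"
      using small B(3) that by blast
    have "0 < gcd_maximal_minors B" by (rule card_support_le_gram(1)[OF B(1)]) (rule smallB)
    \<comment> \<open>Nothing is known about the minors of \<open>B\<close> beyond their gcd being a
      positive integer, so it is bounded below by 1.\<close>
    hence "2 ^ s * 1 \<le> 2 ^ s * real_of_int (gcd_maximal_minors B)" by (intro mult_left_mono) auto
    also have "\<dots> \<le> 2 ^ m * sqrt (real_of_int (det (B ** transpose B)))"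
      unfolding s_def m_def by (rule card_support_le_gram(2)[OF B(1)]) (rule smallB)
    also have "\<dots> \<le> 2 ^ m * sqrt ((real s * a\<^sup>2) ^ m)" using det by (intro mult_left_mono real_sqrt_le_mono) auto
    also have "\<dots> = (2 * sqrt (real s) * a) ^ m"
      using a by (simp add: real_sqrt_power real_sqrt_mult power_mult_distrib)
    finally have "2 ^ s \<le> (2 * sqrt (real s) * a) ^ m" by simp
    hence "log 2 (2 ^ s) \<le> log 2 ((2 * sqrt (real s) * a) ^ m)" using s a by (subst log_le_cancel_iff) auto
    hence "real s \<le> real m * log 2 (2 * sqrt (real s) * a)" using s a by (simp add: log_nat_power)
    hence t: "real s / real m \<le> log 2 (2 * sqrt (real s) * a)" using m by (simp add: field_simps)
    have "sqrt (real s) = sqrt (real m) * sqrt (real s / real m)" using m by (simp flip: real_sqrt_mult)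
    hence "log 2 (2 * sqrt (real s) * a) = log 2 ((2 * sqrt (real m) * a) * sqrt (real s / real m))"
      by (simp add: mult_ac)
    also have "\<dots> = log 2 (2 * sqrt (real m) * a) + log 2 (sqrt (real s / real m))"
      using a m s by (intro log_mult_pos) auto
    also have "log 2 (sqrt (real s / real m)) = log 2 (real s / real m) / 2"
      using m s by (simp add: log_def ln_sqrt)
    also have "\<dots> \<le> (real s / real m) / 2" using m s by (intro divide_right_mono log2_le_self) auto
    finally have "(real s / real m) / 2 \<le> log 2 (2 * sqrt (real m) * a)" using t by linarith
    thus ?thesis using m by (simp add: field_simps s_def m_def a_def)
  qed
qed

section \<open>Optimal solutions of minimal support\<close>

text \<open>The objective takes integer values, so its distance to an upper bound is a natural
  number and attains its minimum.\<close>

lemma ip_optimal_exists: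
  assumes "ip_feasible A b \<noteq> {}" and "bdd_above (ip_objective c ` ip_feasible A b)"
  shows "\<exists>z. ip_optimal A b c z"
proof -
  obtain M where M: "\<And>x. x \<in> ip_feasible A b \<Longrightarrow> ip_objective c x \<le> M"
    using assms(2) by (auto simp: bdd_above_def)
  obtain x0 where "x0 \<in> ip_feasible A b" using assms(1) by auto
  then obtain z where z: "z \<in> ip_feasible A b" and
    min: "\<And>x. x \<in> ip_feasible A b \<Longrightarrow> nat (M - ip_objective c z) \<le> nat (M - ip_objective c x)"
    using ex_has_least_nat[of "\<lambda>x. x \<in> ip_feasible A b" x0 "\<lambda>x. nat (M - ip_objective c x)"] by blast
  have "ip_objective c x \<le> ip_objective c z" if "x \<in> ip_feasible A b" for x
    using min[OF that] M[OF that] M[OF z] by linarith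
  thus ?thesis using z by (auto simp: ip_optimal_def)
qed

lemma int_matrix_vector_scale: "A *v (k *s w) = k *s (A *v w)" for A :: "int^'n^'m"
  by (simp add: vec_eq_iff matrix_vector_mult_def sum_distrib_left mult_ac)

text \<open>By optimality the objective vanishes on such a \<open>y\<close>, so one can move along \<open>y\<close> until a
  coordinate of the support drops to zero.\<close>

lemma minimal_support_no_small_relation:
  fixes A :: "int^'n^'m" and y z :: "int^'n"
  assumes opt: "ip_optimal A b c z"
    and min: "\<And>z'. ip_optimal A b c z' \<Longrightarrow> card (supp z) \<le> card (supp z')"
    and y: "A *v y = 0" "\<And>i. \<bar>y $ i\<bar> \<le> 1" "\<And>i. i \<notin> supp z \<Longrightarrow> y $ i = 0"
  shows "y = 0"
proof -
  have z: "A *v z = b" "\<And>i. 0 \<le> z $ i" and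
    best: "\<And>x. x \<in> ip_feasible A b \<Longrightarrow> ip_objective c x \<le> ip_objective c z"
    using opt by (auto simp: ip_optimal_def ip_feasible_def less_eq_vec_def)
  have nonpos: "w $ i \<le> 0"
    if w: "A *v w = 0" "\<And>i. \<bar>w $ i\<bar> \<le> 1" "\<And>i. i \<notin> supp z \<Longrightarrow> w $ i = 0" for w i
  proof (rule ccontr)
    assume "\<not> w $ i \<le> 0"
    hence wi: "w $ i = 1" using w(2)[of i] by linarith
    have A: "A *v (z + k *s w) = b" for k
      by (simp add: matrix_vector_right_distrib int_matrix_vector_scale z w)
    have obj: "ip_objective c (z + k *s w) = ip_objective c z + k * ip_objective c w" for k
      by (simp add: ip_objective_def distrib_left sum.distrib sum_distrib_left mult_ac)
    \<comment> \<open>Where \<open>w\<close> is nonzero, \<open>z\<close> is at least 1, so both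
      \<open>z + w\<close> and \<open>z - w\<close> are feasible and optimality forces the objective
      of \<open>w\<close> to vanish.\<close>
    have pos: "1 \<le> z $ j" if "w $ j \<noteq> 0" for j
      using w(3)[of j] z(2)[of j] that by (cases "j \<in> supp z") (auto simp: supp_def)
    have feas: "z + k *s w \<in> ip_feasible A b" if "k = 1 \<or> k = -1" for k
    proof -
      have "0 \<le> z $ j + k * w $ j" for j
        using pos[of j] z(2)[of j] w(2)[of j] that by (cases "w $ j = 0") auto
      thus ?thesis by (auto simp: ip_feasible_def A less_eq_vec_def)
    qed
    have obj0: "ip_objective c w = 0"
      using best[OF feas[of 1]] best[OF feas[of "-1"]] unfolding obj by simp
    let ?I = "{j. w $ j = 1}"
    \<comment> \<open>The longest feasible step against \<open>w\<close>: only the coordinates with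
      \<open>w $ j = 1\<close> decrease, and one of them reaches 0.\<close>
    define t where "t = Min ((\<lambda>j. z $ j) ` ?I)"
    have tle: "t \<le> z $ j" if "w $ j = 1" for j unfolding t_def using that by (intro Min_le) auto
    have "t \<in> (\<lambda>j. z $ j) ` ?I" unfolding t_def using wi by (intro Min_in) auto
    then obtain l where l: "w $ l = 1" "t = z $ l" by auto
    have t0: "0 \<le> t" using l z by simp
    define z' where "z' = z + (- t) *s w"
    have "0 \<le> z' $ j" for j
    proof -
      have "w $ j = 1 \<or> w $ j \<le> 0" using w(2)[of j] by linarith
      thus ?thesis
      proof
        assume "w $ j \<le> 0"
        hence "t * w $ j \<le> 0" using t0 by (simp add: mult_le_0_iff)
        thus ?thesis using z(2)[of j] by (simp add: z'_def)
      qed (use tle in \<open>simp add: z'_def\<close>)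
    qed
    hence "z' \<in> ip_feasible A b" unfolding z'_def using A by (auto simp: ip_feasible_def less_eq_vec_def)
    moreover have "ip_objective c z' = ip_objective c z" unfolding z'_def obj obj0 by simp
    ultimately have opt': "ip_optimal A b c z'" using best by (simp add: ip_optimal_def)
    have "supp z' \<subseteq> supp z" using w(3) by (force simp: supp_def z'_def)
    moreover have "l \<in> supp z" using pos[of l] l by (auto simp: supp_def)
    moreover have "l \<notin> supp z'" using l by (simp add: supp_def z'_def)
    ultimately have "supp z' \<subset> supp z" by auto
    hence "card (supp z') < card (supp z)" by (intro psubset_card_mono) auto
    thus False using min[OF opt'] by simp
  qed
  have "A *v (- y) = 0" using y(1) int_matrix_vector_scale[of A "-1" y] by (simp add: vector_sneg_minus1[symmetric])
  hence "(- y) $ i \<le> 0" for i using y by (intro nonpos) auto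
  moreover have "y $ i \<le> 0" for i using y by (intro nonpos) auto
  ultimately show "y = 0" by (simp add: vec_eq_iff order_antisym)
qed

theorem theorem1:
  fixes A :: "int ^ 'n ^ 'm" and b :: "int ^ 'm" and c :: "int ^ 'n"
  assumes full_row_rank: "rank (map_matrix real_of_int A) = CARD('m)"
    and feasible: "ip_feasible A b \<noteq> {}"
    and bounded: "bdd_above (ip_objective c ` ip_feasible A b)"
  shows "\<exists>z. ip_optimal A b c z \<and>
    real (card (supp z)) \<le> real CARD('m) +
      log 2 (inverse (real_of_int (gcd_maximal_minors A)) *
             sqrt (real_of_int (det (A ** transpose A)))) \<and>
    real (card (supp z)) \<le> 2 * real CARD('m) *
      log 2 (2 * sqrt (real CARD('m)) * real_of_int (max_abs_entry A))"
proof -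
  obtain z0 where "ip_optimal A b c z0" using ip_optimal_exists[OF feasible bounded] by blast
  then obtain z where z: "ip_optimal A b c z"
    and min: "\<And>z'. ip_optimal A b c z' \<Longrightarrow> card (supp z) \<le> card (supp z')"
    using ex_has_least_nat[of "ip_optimal A b c" z0 "\<lambda>z. card (supp z)"] by blast
  let ?g = "real_of_int (gcd_maximal_minors A)" and ?d = "sqrt (real_of_int (det (A ** transpose A)))"
  note small = minimal_support_no_small_relation[OF z min]
  have "0 < gcd_maximal_minors A" by (rule card_support_le_gram(1)[OF full_row_rank]) (rule small)
  hence g: "0 < ?g" by simp
  have le: "2 ^ card (supp z) * ?g \<le> 2 ^ CARD('m) * ?d"
    by (rule card_support_le_gram(2)[OF full_row_rank]) (rule small)
  \<comment> \<open>The determinant is positive because the left side of \<open>le\<close> is; this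
    legitimises the logarithm.\<close>
  have "0 < 2 ^ CARD('m) * ?d" by (rule less_le_trans[OF _ le]) (use g in simp)
  hence d: "0 < ?d" by (simp add: zero_less_mult_iff)
  have "2 ^ card (supp z) \<le> 2 ^ CARD('m) * (inverse ?g * ?d)" using le g by (simp add: field_simps)
  hence "log 2 (2 ^ card (supp z)) \<le> log 2 (2 ^ CARD('m) * (inverse ?g * ?d))"
    using g d by (subst log_le_cancel_iff) auto
  also have "\<dots> = log 2 (2 ^ CARD('m)) + log 2 (inverse ?g * ?d)"
    using g d by (intro log_mult_pos) auto
  finally have "real (card (supp z)) \<le> real CARD('m) + log 2 (inverse ?g * ?d)"
    by (simp add: log_nat_power)
  moreover have "real (card (supp z)) \<le> 2 * real CARD('m) *
      log 2 (2 * sqrt (real CARD('m)) * real_of_int (max_abs_entry A))"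
    using card_support_le_entries[OF full_row_rank, of "supp z"] small by blast
  ultimately show ?thesis using z by blast
qed

end
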